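(* Every lattice with at most $7$ elements is a Shannon lattice.
   Context: Lattices have order $\supseteq$, meet $\cap$, join $\uplus$. A polymatroid function on a finite lattice $L$ is $h:L\to\mathbb{R}$ that is non-negative, increasing ($x\supseteq y\Rightarrow h(x)\ge h(y)$) and submodular ($h(x)+h(y)\ge h(x\uplus y)+h(x\cap y)$). $h$ is entropic if there exist jointly distributed discrete random variables $(X_x)_{x\in L}$ such that for all $x,y$ the variable $X_{x\uplus y}$ and the pair $(X_x,X_y)$ are functions of each other, and $h(x)=H(X_x)$ (Shannon entropy) for all $x$. $L$ is a Shannon lattice if the set of polymatroid functions on $L$ equals the closure in $\mathbb{R}^L$ of the set of entropic functions on $L$. *)

theory Defs
  imports "HOL-Analysis.Analysis" "HOL-Probability.Probability"
begin

text \<open>Lattices are instances of the type class lattice: order \<le> (the paper's \<supseteq> read as \<ge>),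
  meet = inf, join = sup. The space R^L carries the product topology on functions L \<Rightarrow> real.\<close>

definition polymatroid :: "('a::lattice \<Rightarrow> real) \<Rightarrow> bool" where
  "polymatroid h \<longleftrightarrow>
     (\<forall>x. h x \<ge> 0) \<and>
     (\<forall>x y. y \<le> x \<longrightarrow> h y \<le> h x) \<and>
     (\<forall>x y. h x + h y \<ge> h (sup x y) + h (inf x y))"

definition finite_entropy :: "'b pmf \<Rightarrow> bool" where
  "finite_entropy q \<longleftrightarrow> (\<lambda>v. pmf q v * log 2 (pmf q v)) summable_on UNIV"

definition shannon_entropy :: "'b pmf \<Rightarrow> real" where
  "shannon_entropy q = - (\<Sum>\<^sub>\<infinity>v. pmf q v * log 2 (pmf q v))"

text \<open>Entropic: a joint distribution \<mu> of a family of discrete (nat-valued, i.e. countably valued)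
  random variables X_x = (\<lambda>\<omega>. \<omega> x), such that X_(x join y) and (X_x, X_y) are (almost surely)
  functions of each other, and h x = H(X_x).\<close>
definition entropic :: "('a::lattice \<Rightarrow> real) \<Rightarrow> bool" where
  "entropic h \<longleftrightarrow>
     (\<exists>\<mu> :: ('a \<Rightarrow> nat) pmf.
        (\<forall>x y. \<exists>f g. \<forall>\<omega>\<in>set_pmf \<mu>.
            \<omega> (sup x y) = f (\<omega> x, \<omega> y) \<and> (\<omega> x, \<omega> y) = g (\<omega> (sup x y))) \<and>
        (\<forall>x. finite_entropy (map_pmf (\<lambda>\<omega>. \<omega> x) \<mu>) \<and>
             h x = shannon_entropy (map_pmf (\<lambda>\<omega>. \<omega> x) \<mu>)))"

definition shannon_lattice :: "'a::{finite,lattice} itself \<Rightarrow> bool" where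
  "shannon_lattice _ \<longleftrightarrow>
     {h :: 'a \<Rightarrow> real. polymatroid h} = closure {h :: 'a \<Rightarrow> real. entropic h}"

end

theory Submission
  imports Defs "HOL-Real_Asymp.Real_Asymp" "HOL-Number_Theory.Cong"
begin

text \<open>
  Shannon's inequalities give one inclusion. For the other one, call \<open>h\<close> approximable if it is a limit
  of functions \<open>g / m\<close>, where \<open>g\<close> comes from variables that are all uniform on their range; diluting
  such variables shows that approximable functions are limits of entropic ones, and they form a closed
  convex cone. A lattice with at most 7 elements has at most 3 join-irreducible elements or at most 2
  joins of incomparable elements.

  In the first case a polymatroid function is a function of three variables. It is a combination of
  step functions and of the rank function of three vectors in general position in a plane.

  In the second case the joins of incomparable elements form a chain. Round the polymatroid function
  to an integral one \<open>d\<close>, let \<open>t\<close> run through this chain, let \<open>W t\<close> be nested spaces of dimension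
  \<open>d t\<close> over a large prime field, and give each \<open>x\<close> as many generic new vectors from the \<open>W t\<close> with
  the least \<open>t\<close> above \<open>x\<close> as are needed to increase the dimension from \<open>d\<close> of the lower cover to \<open>d x\<close>.
  Submodularity says precisely that two incomparable elements then span \<open>W t\<close> for their join \<open>t\<close>.
\<close>

section \<open>Entropic functions are polymatroid functions\<close>

text \<open>For real families summability is absolute summability, so the sum is a Lebesgue
  integral. As expectations, entropies can be compared pointwise on the support.\<close>

lemma finite_entropy_integrable:
  fixes q :: "'b pmf"
  assumes "finite_entropy q"
  shows "integrable (measure_pmf q) (\<lambda>v. log 2 (pmf q v))"
    and "shannon_entropy q = - measure_pmf.expectation q (\<lambda>v. log 2 (pmf q v))"
proof -
  let ?g = "\<lambda>v. pmf q v * log 2 (pmf q v)"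
  have s: "?g summable_on UNIV"
    using assms by (simp add: finite_entropy_def)
  hence "(\<lambda>v. norm (?g v)) summable_on UNIV"
    by (rule summable_on_iff_abs_summable_on_real[THEN iffD1])
  hence a: "Infinite_Set_Sum.abs_summable_on ?g UNIV"
    by (rule abs_summable_equivalent[THEN iffD1])
  hence i: "integrable (count_space UNIV) ?g"
    by (simp add: abs_summable_on_def)
  show "integrable (measure_pmf q) (\<lambda>v. log 2 (pmf q v))"
    unfolding measure_pmf_eq_density using i by (subst integrable_density) auto
  have "infsum ?g UNIV = integral\<^sup>L (count_space UNIV) ?g"
    using infsetsum_infsum[OF a]
    by (simp add: infsetsum_def)
  also have "\<dots> = measure_pmf.expectation q (\<lambda>v. log 2 (pmf q v))"
    unfolding measure_pmf_eq_density using i by (subst integral_density) auto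
  finally show "shannon_entropy q = - measure_pmf.expectation q (\<lambda>v. log 2 (pmf q v))"
    by (simp add: shannon_entropy_def)
qed

definition marginal :: "('a \<Rightarrow> nat) pmf \<Rightarrow> 'a \<Rightarrow> nat pmf" where
  "marginal \<mu> x = map_pmf (\<lambda>\<omega>. \<omega> x) \<mu>"

lemma marginal_pos: "\<omega> \<in> set_pmf \<mu> \<Longrightarrow> 0 < pmf (marginal \<mu> x) (\<omega> x)"
  by (auto simp: marginal_def pmf_positive_iff)

lemma pmf_marginal: "pmf (marginal \<mu> x) v = measure_pmf.prob \<mu> {\<omega>. \<omega> x = v}"
  by (simp add: marginal_def pmf_map vimage_def)

lemma marginal_entropy:
  assumes "finite_entropy (marginal \<mu> x)"
  shows "integrable (measure_pmf \<mu>) (\<lambda>\<omega>. log 2 (pmf (marginal \<mu> x) (\<omega> x)))"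
    and "shannon_entropy (marginal \<mu> x) =
           - measure_pmf.expectation \<mu> (\<lambda>\<omega>. log 2 (pmf (marginal \<mu> x) (\<omega> x)))"
  using finite_entropy_integrable[OF assms]
  by (auto simp: marginal_def)

text \<open>By \<open>ln t \<le> t - 1\<close> it suffices that \<open>p(x) p(y) / (p(x,y) p(m))\<close> has expectation at most 1;
  summing over the values of \<open>X\<close> and \<open>Y\<close> that agree on the common function \<open>m\<close> gives this.\<close>

lemma marginal_submodular:
  assumes fin: "\<And>x. finite_entropy (marginal \<mu> x)"
    and fx: "\<And>\<omega>. \<omega> \<in> set_pmf \<mu> \<Longrightarrow> \<omega> m = f (\<omega> x)"
    and fy: "\<And>\<omega>. \<omega> \<in> set_pmf \<mu> \<Longrightarrow> \<omega> m = g (\<omega> y)"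
    and j: "\<And>\<omega> \<omega>'. \<omega> \<in> set_pmf \<mu> \<Longrightarrow> \<omega>' \<in> set_pmf \<mu> \<Longrightarrow>
              \<omega> z = \<omega>' z \<longleftrightarrow> \<omega> x = \<omega>' x \<and> \<omega> y = \<omega>' y"
  shows "shannon_entropy (marginal \<mu> z) + shannon_entropy (marginal \<mu> m) \<le>
         shannon_entropy (marginal \<mu> x) + shannon_entropy (marginal \<mu> y)"
proof -
  define P where "P x \<omega> = pmf (marginal \<mu> x) (\<omega> x)" for x and \<omega> :: "'a \<Rightarrow> nat"
  define q where "q = map_pmf (\<lambda>\<omega>. (\<omega> x, \<omega> y)) \<mu>"
  define R where "R \<omega> = P x \<omega> * P y \<omega> / (P z \<omega> * P m \<omega>)" for \<omega>
  have pos: "P x \<omega> > 0" if "\<omega> \<in> set_pmf \<mu>" for x \<omega>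
    using marginal_pos[OF that] by (simp add: P_def)
  have nonneg: "P x \<omega> \<ge> 0" for x \<omega> by (simp add: P_def)
  \<comment> \<open>By \<open>j\<close>, \<open>X_z\<close> and the pair \<open>(X_x, X_y)\<close>
    determine each other on the support, so both take their values with the same
    probability.\<close>
  have Pz: "P z \<omega> = pmf q (\<omega> x, \<omega> y)" if w: "\<omega> \<in> set_pmf \<mu>" for \<omega>
  proof -
    have "P z \<omega> = measure_pmf.prob \<mu> {\<omega>'. \<omega>' z = \<omega> z}"
      by (simp add: P_def pmf_marginal)
    also have "\<dots> = measure_pmf.prob \<mu> {\<omega>'. (\<omega>' x, \<omega>' y) = (\<omega> x, \<omega> y)}"
      using j[OF _ w] by (intro measure_pmf.finite_measure_eq_AE) (auto simp: AE_measure_pmf_iff)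
    finally show ?thesis by (simp add: q_def pmf_map vimage_def)
  qed
  have mm: "measure_pmf.prob (marginal \<mu> y) {b. g b = c} = pmf (marginal \<mu> m) c" for c
  proof -
    have "measure_pmf.prob (marginal \<mu> y) {b. g b = c} = measure_pmf.prob \<mu> {\<omega>. g (\<omega> y) = c}"
      by (simp add: marginal_def vimage_def)
    also have "\<dots> = measure_pmf.prob \<mu> {\<omega>. \<omega> m = c}"
      using fy by (intro measure_pmf.finite_measure_eq_AE) (auto simp: AE_measure_pmf_iff)
    finally show ?thesis by (simp add: pmf_marginal)
  qed
  define G :: "nat \<times> nat \<Rightarrow> real" where
    "G = (\<lambda>(a, b). pmf (marginal \<mu> x) a * pmf (marginal \<mu> y) b / pmf (marginal \<mu> m) (f a))"
  define I :: "nat \<times> nat \<Rightarrow> ennreal" where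
    "I = (\<lambda>(a, b). indicator {b. g b = f a} b * ennreal (1 / pmf (marginal \<mu> m) (f a)))"
  have "(\<integral>\<^sup>+\<omega>. ennreal (R \<omega>) \<partial>\<mu>) = (\<integral>\<^sup>+\<omega>. ennreal (G (\<omega> x, \<omega> y) / pmf q (\<omega> x, \<omega> y)) \<partial>\<mu>)"
  proof (rule nn_integral_cong_AE, unfold AE_measure_pmf_iff, rule ballI)
    fix \<omega> assume w: "\<omega> \<in> set_pmf \<mu>"
    show "ennreal (R \<omega>) = ennreal (G (\<omega> x, \<omega> y) / pmf q (\<omega> x, \<omega> y))"
      unfolding R_def Pz[OF w] by (simp add: G_def P_def fx[OF w])
  qed
  also have "\<dots> = (\<integral>\<^sup>+v. ennreal (G v / pmf q v) \<partial>q)"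
    by (simp add: q_def)
  also have "\<dots> = (\<integral>\<^sup>+v. ennreal (pmf q v) * ennreal (G v / pmf q v) \<partial>count_space UNIV)"
    by (simp add: nn_integral_measure_pmf)
  \<comment> \<open>On the support of \<open>q\<close> the factor \<open>pmf q v\<close> cancels and
    \<open>g b = f a\<close> holds; off it the left side is 0. The right side integrates
    \<open>I\<close> over independent copies of \<open>X_x\<close> and \<open>X_y\<close>.\<close>
  also have "\<dots> \<le> (\<integral>\<^sup>+v. ennreal (pmf (pair_pmf (marginal \<mu> x) (marginal \<mu> y)) v) * I v \<partial>count_space UNIV)"
  proof (rule nn_integral_mono)
    fix v :: "nat \<times> nat"
    obtain a b where v: "v = (a, b)" by (cases v)
    show "ennreal (pmf q v) * ennreal (G v / pmf q v) \<le>
        ennreal (pmf (pair_pmf (marginal \<mu> x) (marginal \<mu> y)) v) * I v"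
    proof (cases "v \<in> set_pmf q")
      case True
      then obtain \<omega> where w: "\<omega> \<in> set_pmf \<mu>" "a = \<omega> x" "b = \<omega> y"
        by (auto simp: q_def v)
      have "pmf q v > 0" using True by (simp add: pmf_positive_iff)
      moreover have "g b = f a" using w fx fy by metis
      moreover have "G v \<ge> 0" by (simp add: G_def v)
      ultimately show ?thesis
        by (simp add: v I_def G_def pmf_pair ennreal_mult'[symmetric])
    next
      case False
      then show ?thesis by (simp add: set_pmf_iff)
    qed
  qed
  also have "\<dots> = (\<integral>\<^sup>+v. I v \<partial>pair_pmf (marginal \<mu> x) (marginal \<mu> y))"
    by (simp add: nn_integral_measure_pmf)
  also have "\<dots> = (\<integral>\<^sup>+a. \<integral>\<^sup>+b. I (a, b) \<partial>marginal \<mu> y \<partial>marginal \<mu> x)"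
    by (simp add: nn_integral_pair_pmf')
  also have "\<dots> \<le> (\<integral>\<^sup>+a. 1 \<partial>marginal \<mu> x)"
  proof (rule nn_integral_mono)
    \<comment> \<open>For fixed \<open>a\<close> the event \<open>g b = f a\<close> has exactly the
      probability that \<open>I\<close> divides by. The product is 1, or 0 if this probability
      vanishes.\<close>
    fix a
    have "(\<integral>\<^sup>+b. I (a, b) \<partial>marginal \<mu> y) =
        ennreal (pmf (marginal \<mu> m) (f a)) * ennreal (1 / pmf (marginal \<mu> m) (f a))"
      by (simp add: I_def nn_integral_multc measure_pmf.emeasure_eq_measure mm)
    also have "\<dots> \<le> 1"
      by (simp add: ennreal_mult'[symmetric])
    finally show "(\<integral>\<^sup>+b. I (a, b) \<partial>marginal \<mu> y) \<le> 1" .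
  qed
  also have "\<dots> = 1" by simp
  finally have R1: "(\<integral>\<^sup>+\<omega>. ennreal (R \<omega>) \<partial>\<mu>) \<le> 1" .
  have Rn: "R \<omega> \<ge> 0" for \<omega> by (simp add: R_def nonneg)
  have Ri: "integrable \<mu> R"
    using R1 Rn by (intro integrableI_nonneg) (auto simp: order_le_less_trans)
  have RE: "measure_pmf.expectation \<mu> R \<le> 1"
    using R1 Rn nn_integral_eq_integral[OF Ri] by (simp add: ennreal_le_1)
  let ?l = "\<lambda>x \<omega>. log 2 (P x \<omega>)"
  have li: "integrable \<mu> (?l x)" for x
    using marginal_entropy(1)[OF fin] by (simp add: P_def)
  have "measure_pmf.expectation \<mu> (\<lambda>\<omega>. ?l x \<omega> + ?l y \<omega> - ?l z \<omega> - ?l m \<omega>) \<le>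
      measure_pmf.expectation \<mu> (\<lambda>\<omega>. (R \<omega> - 1) / ln 2)"
  proof (rule integral_mono_AE)
    show "AE \<omega> in \<mu>. ?l x \<omega> + ?l y \<omega> - ?l z \<omega> - ?l m \<omega> \<le> (R \<omega> - 1) / ln 2"
      unfolding AE_measure_pmf_iff
    proof
      fix \<omega> assume w: "\<omega> \<in> set_pmf \<mu>"
      have "ln (R \<omega>) \<le> R \<omega> - 1"
        using pos[OF w] by (intro ln_le_minus_one) (simp add: R_def)
      moreover have "ln (R \<omega>) = ln (P x \<omega>) + ln (P y \<omega>) - ln (P z \<omega>) - ln (P m \<omega>)"
        using pos[OF w] by (simp add: R_def ln_div ln_mult less_imp_neq[symmetric])
      ultimately show "?l x \<omega> + ?l y \<omega> - ?l z \<omega> - ?l m \<omega> \<le> (R \<omega> - 1) / ln 2"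
        by (simp add: log_def divide_right_mono flip: add_divide_distrib diff_divide_distrib)
    qed
  qed (use li Ri in auto)
  also have "\<dots> = (measure_pmf.expectation \<mu> R - 1) / ln 2"
    using Ri by simp
  also have "\<dots> \<le> 0" using RE by (simp add: divide_nonpos_pos)
  finally show ?thesis
    using li marginal_entropy(2)[OF fin] by (simp add: P_def)
qed

text \<open>For \<open>y \<le> x\<close> the join of the two is \<open>x\<close>, so
  \<open>X_y\<close> is a function of \<open>X_x\<close> and its values are at least as probable. In
  particular the variable at \<open>inf x y\<close> is the common function that
  \<open>marginal_submodular\<close> asks for.\<close>

lemma entropic_imp_polymatroid:
  assumes "entropic h"
  shows "polymatroid h"
proof -
  obtain \<mu> where
    sup: "\<forall>x y. \<exists>f g. \<forall>\<omega>\<in>set_pmf \<mu>.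
            \<omega> (sup x y) = f (\<omega> x, \<omega> y) \<and> (\<omega> x, \<omega> y) = g (\<omega> (sup x y))"
    and H: "\<forall>x. finite_entropy (marginal \<mu> x) \<and> h x = shannon_entropy (marginal \<mu> x)"
    using assms unfolding entropic_def marginal_def by (elim exE conjE)
  note sup = sup[rule_format]
  from H have fin: "\<And>x. finite_entropy (marginal \<mu> x)"
    and h: "\<And>x. h x = shannon_entropy (marginal \<mu> x)" by simp_all
  have mono_fun: "\<exists>f. \<forall>\<omega>\<in>set_pmf \<mu>. \<omega> y = f (\<omega> x)" if le: "y \<le> x" for x y
  proof -
    obtain g where g: "\<forall>\<omega>\<in>set_pmf \<mu>. (\<omega> y, \<omega> x) = g (\<omega> x)"
      using sup[of y x] unfolding sup_absorb2[OF le] by blast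
    hence "\<forall>\<omega>\<in>set_pmf \<mu>. \<omega> y = fst (g (\<omega> x))"
      by (metis fst_conv)
    thus ?thesis by (rule exI[of _ "\<lambda>v. fst (g v)"])
  qed
  have mono: "h y \<le> h x" if le: "y \<le> x" for x y
  proof -
    obtain f where f: "\<And>\<omega>. \<omega> \<in> set_pmf \<mu> \<Longrightarrow> \<omega> y = f (\<omega> x)"
      using mono_fun[OF le] by blast
    have "measure_pmf.expectation \<mu> (\<lambda>\<omega>. log 2 (pmf (marginal \<mu> x) (\<omega> x))) \<le>
          measure_pmf.expectation \<mu> (\<lambda>\<omega>. log 2 (pmf (marginal \<mu> y) (\<omega> y)))"
    proof (intro integral_mono_AE marginal_entropy(1) fin)
      show "AE \<omega> in \<mu>. log 2 (pmf (marginal \<mu> x) (\<omega> x)) \<le> log 2 (pmf (marginal \<mu> y) (\<omega> y))"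
        unfolding AE_measure_pmf_iff
      proof
        fix \<omega> assume w: "\<omega> \<in> set_pmf \<mu>"
        have "pmf (marginal \<mu> x) (\<omega> x) \<le> pmf (marginal \<mu> y) (\<omega> y)"
          unfolding pmf_marginal f[OF w]
          by (intro measure_pmf.finite_measure_mono_AE) (auto simp: AE_measure_pmf_iff f)
        thus "log 2 (pmf (marginal \<mu> x) (\<omega> x)) \<le> log 2 (pmf (marginal \<mu> y) (\<omega> y))"
          using marginal_pos[OF w] by simp
      qed
    qed
    thus ?thesis by (simp add: h marginal_entropy(2)[OF fin])
  qed
  have nonneg: "h x \<ge> 0" for x
  proof -
    have "measure_pmf.expectation \<mu> (\<lambda>\<omega>. log 2 (pmf (marginal \<mu> x) (\<omega> x))) \<le>
        measure_pmf.expectation \<mu> (\<lambda>\<omega>. 0)"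
      by (intro integral_mono_AE marginal_entropy(1) fin)
         (auto simp: AE_measure_pmf_iff marginal_pos pmf_le_1)
    thus ?thesis by (simp add: h marginal_entropy(2)[OF fin])
  qed
  have submod: "h (sup x y) + h (inf x y) \<le> h x + h y" for x y
  proof -
    obtain f where f: "\<And>\<omega>. \<omega> \<in> set_pmf \<mu> \<Longrightarrow> \<omega> (inf x y) = f (\<omega> x)"
      using mono_fun[of "inf x y" x] by auto
    obtain g where g: "\<And>\<omega>. \<omega> \<in> set_pmf \<mu> \<Longrightarrow> \<omega> (inf x y) = g (\<omega> y)"
      using mono_fun[of "inf x y" y] by auto
    obtain u v where uv: "\<forall>\<omega>\<in>set_pmf \<mu>. \<omega> (sup x y) = u (\<omega> x, \<omega> y) \<and> (\<omega> x, \<omega> y) = v (\<omega> (sup x y))"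
      using sup[of x y] by (elim exE)
    have "\<omega> (sup x y) = \<omega>' (sup x y) \<longleftrightarrow> \<omega> x = \<omega>' x \<and> \<omega> y = \<omega>' y"
      if "\<omega> \<in> set_pmf \<mu>" "\<omega>' \<in> set_pmf \<mu>" for \<omega> \<omega>'
      using uv[rule_format, OF that(1)] uv[rule_format, OF that(2)] by (metis prod.inject)
    hence "shannon_entropy (marginal \<mu> (sup x y)) + shannon_entropy (marginal \<mu> (inf x y)) \<le>
           shannon_entropy (marginal \<mu> x) + shannon_entropy (marginal \<mu> y)"
      by (intro marginal_submodular[where f = f and g = g] fin f g)
    thus ?thesis by (simp add: h)
  qed
  show ?thesis using mono nonneg submod unfolding polymatroid_def by blast
qed

section \<open>The closure of the entropic functions\<close>

lemma closure_fun_iff: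
  fixes A :: "('a::finite \<Rightarrow> real) set"
  shows "h \<in> closure A \<longleftrightarrow> (\<forall>e>0. \<exists>g\<in>A. \<forall>x. \<bar>g x - h x\<bar> < e)"
proof
  assume h: "h \<in> closure A"
  show "\<forall>e>0. \<exists>g\<in>A. \<forall>x. \<bar>g x - h x\<bar> < e"
  proof (intro allI impI)
    fix e :: real assume e: "e > 0"
    let ?U = "Pi\<^sub>E UNIV (\<lambda>x. ball (h x) e)"
    have "open ?U" by (rule open_PiE) auto
    moreover have "h \<in> ?U" using e by auto
    ultimately have "?U \<inter> A \<noteq> {}"
      using h unfolding closure_iff_nhds_not_empty by blast
    then obtain g where "g \<in> A" "g \<in> ?U" by blast
    thus "\<exists>g\<in>A. \<forall>x. \<bar>g x - h x\<bar> < e"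
      by (auto simp: PiE_UNIV_domain dist_real_def abs_minus_commute intro!: bexI[of _ g])
  qed
next
  assume a: "\<forall>e>0. \<exists>g\<in>A. \<forall>x. \<bar>g x - h x\<bar> < e"
  show "h \<in> closure A"
    unfolding closure_iff_nhds_not_empty
  proof (intro allI impI)
    fix S V :: "('a \<Rightarrow> real) set" assume V: "V \<subseteq> S" "open V" "h \<in> V"
    then obtain X where X: "h \<in> Pi\<^sub>E UNIV X" "\<And>i. open (X i)" "Pi\<^sub>E UNIV X \<subseteq> V"
      using product_topology_open_contains_basis[of "\<lambda>_. euclidean" UNIV V h]
      by (auto simp: euclidean_product_topology)
    have "\<exists>e>0. ball (h i) e \<subseteq> X i" for i
      using X by (auto simp: open_contains_ball)
    then obtain e where e: "\<And>i. e i > 0" "\<And>i. ball (h i) (e i) \<subseteq> X i" by metis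
    \<comment> \<open>Finitely many coordinates allow one radius for all: the product topology is
      that of uniform approximation.\<close>
    have "Min (range e) > 0" using e by (simp add: Min_gr_iff)
    then obtain g where g: "g \<in> A" "\<And>x. \<bar>g x - h x\<bar> < Min (range e)" using a by blast
    have "g x \<in> X x" for x
    proof -
      have "Min (range e) \<le> e x" by (rule Min_le) auto
      with g(2)[of x] have "\<bar>h x - g x\<bar> < e x" by linarith
      hence "g x \<in> ball (h x) (e x)" by (simp add: dist_real_def)
      thus ?thesis using e(2) by blast
    qed
    hence "g \<in> V" using X(3) by auto
    thus "A \<inter> S \<noteq> {}" using g V by blast
  qed
qed

lemma closure_entropic_polymatroid:
  "closure {h :: 'a::{finite,lattice} \<Rightarrow> real. entropic h} \<subseteq> {h. polymatroid h}"
proof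
  fix h :: "'a \<Rightarrow> real" assume h: "h \<in> closure {h. entropic h}"
  have appr: "\<exists>g. polymatroid g \<and> (\<forall>x. \<bar>g x - h x\<bar> < e)" if "e > 0" for e :: real
  proof -
    obtain g where "g \<in> {h. entropic h}" "\<forall>x. \<bar>g x - h x\<bar> < e"
      using h[unfolded closure_fun_iff, rule_format, OF \<open>e > 0\<close>] by (elim bexE)
    thus ?thesis using entropic_imp_polymatroid by auto
  qed
  \<comment> \<open>Each polymatroid inequality involves at most four values of \<open>h\<close>,
    each within \<open>e\<close> of the value of \<open>g\<close>.\<close>
  have le: "s \<le> t" if "\<And>e. e > 0 \<Longrightarrow> s \<le> t + 4 * e" for s t :: real
  proof (rule field_le_epsilon)
    fix e :: real assume "e > 0"
    thus "s \<le> t + e" using that[of "e / 4"] by simp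
  qed
  have "0 \<le> h x" for x
  proof (rule le)
    fix e :: real assume "e > 0"
    then obtain g where "polymatroid g" "\<forall>x. \<bar>g x - h x\<bar> < e" using appr by blast
    hence "g x \<ge> 0" "\<bar>g x - h x\<bar> < e" by (auto simp: polymatroid_def)
    thus "0 \<le> h x + 4 * e" using \<open>e > 0\<close> by linarith
  qed
  moreover have "h y \<le> h x" if "y \<le> x" for x y
  proof (rule le)
    fix e :: real assume "e > 0"
    then obtain g where "polymatroid g" "\<forall>x. \<bar>g x - h x\<bar> < e" using appr by blast
    hence "g y \<le> g x" "\<bar>g x - h x\<bar> < e" "\<bar>g y - h y\<bar> < e"
      using that by (auto simp: polymatroid_def)
    thus "h y \<le> h x + 4 * e" using \<open>e > 0\<close> by linarith
  qed
  moreover have "h (sup x y) + h (inf x y) \<le> h x + h y" for x y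
  proof (rule le)
    fix e :: real assume "e > 0"
    then obtain g where g: "polymatroid g" "\<forall>x. \<bar>g x - h x\<bar> < e" using appr by blast
    hence "g (sup x y) + g (inf x y) \<le> g x + g y" by (auto simp: polymatroid_def)
    moreover have "\<bar>g x - h x\<bar> < e" "\<bar>g y - h y\<bar> < e" "\<bar>g (sup x y) - h (sup x y)\<bar> < e"
      "\<bar>g (inf x y) - h (inf x y)\<bar> < e" using g(2) by auto
    ultimately show "h (sup x y) + h (inf x y) \<le> h x + h y + 4 * e" by linarith
  qed
  ultimately show "h \<in> {h. polymatroid h}" by (simp add: polymatroid_def)
qed

section \<open>Approximation by uniform variables\<close>

text \<open>Two variables on a finite sample space are functions of each other iff they have the
  same level sets, so the condition on joins only concerns which sample points each
  \<open>F x\<close> separates.\<close>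

definition join_compatible :: "'u set \<Rightarrow> ('a::lattice \<Rightarrow> 'u \<Rightarrow> 'v) \<Rightarrow> bool" where
  "join_compatible V F \<longleftrightarrow> (\<forall>x y. \<forall>u\<in>V. \<forall>v\<in>V.
     F (sup x y) u = F (sup x y) v \<longleftrightarrow> F x u = F x v \<and> F y u = F y v)"

definition fibre :: "'u set \<Rightarrow> ('u \<Rightarrow> 'v) \<Rightarrow> 'u \<Rightarrow> 'u set" where
  "fibre V f u = {v \<in> V. f v = f u}"

lemma entropic_uniform:
  fixes F :: "'a::lattice \<Rightarrow> 'u \<Rightarrow> 'v"
  assumes V: "finite V" "V \<noteq> {}" and F: "join_compatible V F"
  shows "entropic (\<lambda>x. (\<Sum>u\<in>V. log 2 (card V / card (fibre V (F x) u))) / card V)"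
proof -
  define c where "c x u = to_nat_on (F x ` V) (F x u)" for x u
  have c: "c x u = c x v \<longleftrightarrow> F x u = F x v" if "u \<in> V" "v \<in> V" for x u v
    using that V inj_on_to_nat_on[of "F x ` V"]
    by (auto simp: c_def inj_on_def countable_finite)
  define \<mu> where "\<mu> = map_pmf (\<lambda>u x. c x u) (pmf_of_set V)"
  have set: "set_pmf \<mu> = (\<lambda>u x. c x u) ` V"
    using V by (simp add: \<mu>_def)
  have marg: "map_pmf (\<lambda>\<omega>. \<omega> x) \<mu> = map_pmf (c x) (pmf_of_set V)" for x
    by (simp add: \<mu>_def map_pmf_comp)
  have pm: "pmf (map_pmf (c x) (pmf_of_set V)) (c x u) = card (fibre V (F x) u) / card V"
    if "u \<in> V" for x u
  proof -
    have "V \<inter> {v. c x v = c x u} = fibre V (F x) u"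
      using c[OF _ that] by (auto simp: fibre_def)
    thus ?thesis using V by (simp add: pmf_map vimage_def measure_pmf_of_set)
  qed
  have fin: "finite_entropy (map_pmf (c x) (pmf_of_set V))" for x
    unfolding finite_entropy_def
  proof (rule finite_nonzero_values_imp_summable_on)
    have "{v \<in> UNIV. pmf (map_pmf (c x) (pmf_of_set V)) v *
        log 2 (pmf (map_pmf (c x) (pmf_of_set V)) v) \<noteq> 0} \<subseteq> c x ` V"
      using V by (auto simp: set_pmf_iff[symmetric] simp del: mult_eq_0_iff)
    thus "finite {v \<in> UNIV. pmf (map_pmf (c x) (pmf_of_set V)) v *
        log 2 (pmf (map_pmf (c x) (pmf_of_set V)) v) \<noteq> 0}"
      using V by (meson finite_imageI finite_subset)
  qed
  have ent: "shannon_entropy (map_pmf (c x) (pmf_of_set V)) =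
      (\<Sum>u\<in>V. log 2 (card V / card (fibre V (F x) u))) / card V" for x
  proof -
    have pos: "card (fibre V (F x) u) > 0" if "u \<in> V" for u
      using that V by (auto simp: fibre_def card_gt_0_iff)
    have "shannon_entropy (map_pmf (c x) (pmf_of_set V)) =
        - (\<Sum>u\<in>V. log 2 (pmf (map_pmf (c x) (pmf_of_set V)) (c x u))) / card V"
      using V by (simp add: finite_entropy_integrable(2)[OF fin] integral_pmf_of_set)
    also have "(\<Sum>u\<in>V. log 2 (pmf (map_pmf (c x) (pmf_of_set V)) (c x u))) =
        (\<Sum>u\<in>V. - log 2 (card V / card (fibre V (F x) u)))"
    proof (rule sum.cong)
      fix u assume u: "u \<in> V"
      have "card V > 0" using V by (simp add: card_gt_0_iff)
      thus "log 2 (pmf (map_pmf (c x) (pmf_of_set V)) (c x u)) =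
          - log 2 (card V / card (fibre V (F x) u))"
        using pos[OF u] by (simp add: pm[OF u] log_divide)
    qed simp
    finally show ?thesis by (simp add: sum_negf)
  qed
  show ?thesis
    unfolding entropic_def
  proof (intro exI[of _ \<mu>] conjI allI)
    fix x y
    let ?f = "\<lambda>(a, b). c (sup x y) (SOME u. u \<in> V \<and> c x u = a \<and> c y u = b)"
    let ?g = "\<lambda>a. let u = (SOME u. u \<in> V \<and> c (sup x y) u = a) in (c x u, c y u)"
    have J: "c (sup x y) u = c (sup x y) v \<longleftrightarrow> c x u = c x v \<and> c y u = c y v"
      if "u \<in> V" "v \<in> V" for u v
      using F that unfolding join_compatible_def by (simp add: c)
    have "\<omega> (sup x y) = ?f (\<omega> x, \<omega> y) \<and> (\<omega> x, \<omega> y) = ?g (\<omega> (sup x y))"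
      if w: "\<omega> \<in> set_pmf \<mu>" for \<omega>
    proof -
      obtain u where u: "u \<in> V" "\<omega> = (\<lambda>x. c x u)" using w by (auto simp: set)
      let ?v = "SOME v. v \<in> V \<and> c x v = c x u \<and> c y v = c y u"
      let ?w = "SOME v. v \<in> V \<and> c (sup x y) v = c (sup x y) u"
      have v: "?v \<in> V \<and> c x ?v = c x u \<and> c y ?v = c y u"
        by (rule someI[of _ u]) (simp add: u)
      have w: "?w \<in> V \<and> c (sup x y) ?w = c (sup x y) u"
        by (rule someI[of _ u]) (simp add: u)
      show ?thesis
        using v w J[of ?v u] J[of ?w u] u by (simp add: Let_def)
    qed
    thus "\<exists>f g. \<forall>\<omega>\<in>set_pmf \<mu>. \<omega> (sup x y) = f (\<omega> x, \<omega> y) \<and> (\<omega> x, \<omega> y) = g (\<omega> (sup x y))"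
      by (intro exI[of _ ?f] exI[of _ ?g] ballI)
  qed (simp_all add: marg fin ent)
qed

section \<open>Variables that are uniform on their range\<close>

definition quasi_uniform :: "('a::lattice \<Rightarrow> real) \<Rightarrow> bool" where
  "quasi_uniform h \<longleftrightarrow> (\<exists>(V :: nat set) (F :: 'a \<Rightarrow> nat \<Rightarrow> nat) c.
     finite V \<and> V \<noteq> {} \<and> join_compatible V F \<and>
     (\<forall>x. \<forall>u\<in>V. card (fibre V (F x) u) = c x) \<and> (\<forall>x. h x = log 2 (card V / real (c x))))"

text \<open>The definition fixes \<open>nat\<close> for sample points and values because a formula
  cannot quantify over types. Numbering the points and recoding the values admits any types.\<close>

lemma quasi_uniformI:
  fixes F :: "'a::lattice \<Rightarrow> 'u \<Rightarrow> 'v" and c :: "'a \<Rightarrow> nat"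
  assumes V: "finite V" "V \<noteq> {}" and F: "join_compatible V F"
    and c: "\<And>x u. u \<in> V \<Longrightarrow> card (fibre V (F x) u) = c x"
    and h: "\<And>x. h x = log 2 (card V / real (c x))"
  shows "quasi_uniform h"
proof -
  obtain b :: "'u \<Rightarrow> nat" where b: "inj_on b V"
    using finite_imp_inj_to_nat_seg[OF V(1)] by blast
  define F' where "F' x n = to_nat_on (F x ` V) (F x (inv_into V b n))" for x n
  have F': "F' x (b u) = F' x (b v) \<longleftrightarrow> F x u = F x v" if "u \<in> V" "v \<in> V" for x u v
    using that V b inj_on_to_nat_on[of "F x ` V"]
    by (auto simp: F'_def inj_on_def countable_finite)
  have fib: "fibre (b ` V) (F' x) (b u) = b ` fibre V (F x) u" if "u \<in> V" for x u
    using that F' by (auto simp: fibre_def)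
  have "card (fibre (b ` V) (F' x) (b u)) = c x" if "u \<in> V" for x u
    unfolding fib[OF that] using c[OF that] b
    by (subst card_image) (auto simp: fibre_def inj_on_def)
  moreover have "join_compatible (b ` V) F'"
    using F by (simp add: join_compatible_def F')
  moreover have "card (b ` V) = card V" using b by (rule card_image)
  ultimately show ?thesis
    unfolding quasi_uniform_def using V h
    by (intro exI[of _ "b ` V"] exI[of _ F'] exI[of _ c]) auto
qed

lemma quasi_uniformE:
  fixes h :: "'a::lattice \<Rightarrow> real"
  assumes "quasi_uniform h"
  obtains V :: "nat set" and F :: "'a \<Rightarrow> nat \<Rightarrow> nat" and c :: "'a \<Rightarrow> nat"
  where "finite V" "V \<noteq> {}" "join_compatible V F"
    "\<forall>x. \<forall>u\<in>V. card (fibre V (F x) u) = c x" "\<forall>x. c x > 0"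
    "\<forall>x. h x = log 2 (card V / real (c x))"
proof -
  obtain V :: "nat set" and F :: "'a \<Rightarrow> nat \<Rightarrow> nat" and c :: "'a \<Rightarrow> nat"
    where V: "finite V" "V \<noteq> {}" "join_compatible V F"
      "\<forall>x. \<forall>u\<in>V. card (fibre V (F x) u) = c x" "\<forall>x. h x = log 2 (card V / real (c x))"
    using assms unfolding quasi_uniform_def by (elim exE conjE)
  obtain u where u: "u \<in> V" using V(2) by blast
  have "c x > 0" for x
  proof -
    have "u \<in> fibre V (F x) u" "finite (fibre V (F x) u)" using u V(1) by (auto simp: fibre_def)
    hence "card (fibre V (F x) u) > 0" by (auto simp: card_gt_0_iff)
    thus ?thesis using V(4) u by simp
  qed
  with V show thesis by (intro that[of V F c]) auto
qed

lemma quasi_uniform_zero: "quasi_uniform (\<lambda>_. 0)"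
  by (rule quasi_uniformI[of "{()}" "\<lambda>_ _. ()" "\<lambda>_. 1"])
     (auto simp: join_compatible_def fibre_def)

text \<open>Independent samples: fibres of the paired variables are products of fibres, and
  logarithms turn products into sums.\<close>

lemma quasi_uniform_add:
  fixes h k :: "'a::lattice \<Rightarrow> real"
  assumes "quasi_uniform h" "quasi_uniform k"
  shows "quasi_uniform (\<lambda>x. h x + k x)"
proof -
  obtain V :: "nat set" and F :: "'a \<Rightarrow> nat \<Rightarrow> nat" and c where V: "finite V" "V \<noteq> {}" "join_compatible V F"
    "\<forall>x. \<forall>u\<in>V. card (fibre V (F x) u) = c x" "\<forall>x. c x > 0"
    "\<forall>x. h x = log 2 (card V / real (c x))"
    by (rule quasi_uniformE[OF assms(1)])
  obtain W :: "nat set" and G :: "'a \<Rightarrow> nat \<Rightarrow> nat" and d where W: "finite W" "W \<noteq> {}" "join_compatible W G"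
    "\<forall>x. \<forall>u\<in>W. card (fibre W (G x) u) = d x" "\<forall>x. d x > 0"
    "\<forall>x. k x = log 2 (card W / real (d x))"
    by (rule quasi_uniformE[OF assms(2)])
  show ?thesis
  proof (rule quasi_uniformI[of "V \<times> W" "\<lambda>x. map_prod (F x) (G x)" "\<lambda>x. c x * d x"])
    show "join_compatible (V \<times> W) (\<lambda>x. map_prod (F x) (G x))"
      using V(3) W(3) unfolding join_compatible_def by (simp, blast)
    fix x
    show "card (fibre (V \<times> W) (map_prod (F x) (G x)) u) = c x * d x" if "u \<in> V \<times> W" for u
    proof -
      have "fibre (V \<times> W) (map_prod (F x) (G x)) u = fibre V (F x) (fst u) \<times> fibre W (G x) (snd u)"
        by (cases u) (auto simp: fibre_def)
      thus ?thesis using that V(4) W(4) by (auto simp: card_cartesian_product)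
    qed
    have "card V > 0" "card W > 0" using V W by (auto simp: card_gt_0_iff)
    thus "h x + k x = log 2 (card (V \<times> W) / real (c x * d x))"
      by (simp add: V(5,6) W(5,6) card_cartesian_product log_mult log_divide)
  qed (use V W in auto)
qed

lemma quasi_uniform_of_nat_mult:
  "quasi_uniform h \<Longrightarrow> quasi_uniform (\<lambda>x. real n * h x)"
proof (induction n)
  case (Suc n)
  from quasi_uniform_add[OF Suc.prems Suc.IH[OF Suc.prems]] show ?case
    by (simp add: algebra_simps)
qed (simp add: quasi_uniform_zero)

text \<open>Reveal the sample only with probability \<open>1 / m\<close>, and otherwise let all variables take one
  and the same dummy value.\<close>

lemma quasi_uniform_dilute:
  fixes h :: "'a::lattice \<Rightarrow> real"
  assumes "quasi_uniform h" "m \<ge> 2"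
  shows "entropic (\<lambda>x. h x / real m +
           (log 2 m / m + (real m - 1) / m * log 2 (m / (real m - 1))))"
proof -
  obtain V :: "nat set" and F :: "'a \<Rightarrow> nat \<Rightarrow> nat" and c where V: "finite V" "V \<noteq> {}" "join_compatible V F"
    "\<forall>x. \<forall>u\<in>V. card (fibre V (F x) u) = c x" "\<forall>x. c x > 0"
    "\<forall>x. h x = log 2 (card V / real (c x))"
    by (rule quasi_uniformE[OF assms(1)])
  define W where "W = {..<m} \<times> V"
  define G :: "'a \<Rightarrow> nat \<times> nat \<Rightarrow> nat option"
    where "G = (\<lambda>x (i, u). if i = 0 then Some (F x u) else None)"
  have W: "finite W" "W \<noteq> {}" using V assms(2) by (auto simp: W_def lessThan_empty_iff)
  have "join_compatible W G"
    using V(3) unfolding join_compatible_def W_def G_def by (auto split: if_splits)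
  note E = entropic_uniform[OF W this]
  have posV: "card V > 0" using V by (auto simp: card_gt_0_iff)
  have "(\<Sum>u\<in>W. log 2 (card W / card (fibre W (G x) u))) / card W =
     h x / m + (log 2 m / m + (real m - 1) / m * log 2 (m / (real m - 1)))" for x
  proof -
    have f0: "fibre W (G x) (0, u) = {0} \<times> fibre V (F x) u" if "u \<in> V" for u
      using assms(2) by (auto simp: fibre_def W_def G_def split: if_splits)
    have f1: "fibre W (G x) (i, u) = {1..<m} \<times> V" if "i > 0" for u i
      using that by (auto simp: fibre_def W_def G_def split: if_splits)
    have cW: "card W = m * card V" by (simp add: W_def card_cartesian_product)
    have split: "{..<m} = insert 0 {1..<m}" using assms(2) by auto
    \<comment> \<open>Points with \<open>i = 0\<close> keep their old fibres, all others form one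
      fibre. The extra term in the result is the entropy of a coin with bias \<open>1 / m\<close>,
      the same for every \<open>x\<close>.\<close>
    have "(\<Sum>w\<in>W. log 2 (card W / card (fibre W (G x) w))) =
        (\<Sum>i<m. \<Sum>u\<in>V. log 2 (card W / card (fibre W (G x) (i, u))))"
      by (simp add: W_def sum.cartesian_product)
    also have "\<dots> = (\<Sum>u\<in>V. log 2 (card W / c x)) +
        (\<Sum>i=1..<m. \<Sum>u\<in>V. log 2 (card W / ((real m - 1) * card V)))"
      unfolding split using assms(2)
      by (simp add: f0 f1 V(4) card_cartesian_product of_nat_diff)
    also have "\<dots> = card V * log 2 (m * (card V / c x)) + (real m - 1) * (card V * log 2 (m / (real m - 1)))"
      using posV assms(2) by (simp add: cW of_nat_diff)
    also have "log 2 (m * (card V / c x)) = log 2 m + h x"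
      using posV V(5)[rule_format, of x] assms(2) by (simp add: V(6) log_mult log_divide)
    finally show ?thesis
      using posV assms(2) by (simp add: cW field_simps)
  qed
  with E show ?thesis by simp
qed

section \<open>The closed convex cone of approximable functions\<close>

definition approximable :: "('a::lattice \<Rightarrow> real) \<Rightarrow> bool" where
  "approximable h \<longleftrightarrow> (\<forall>e>0. \<exists>g m. quasi_uniform g \<and> m > (0::nat) \<and> (\<forall>x. \<bar>g x / m - h x\<bar> < e))"

lemma quasi_uniform_approximable: "quasi_uniform h \<Longrightarrow> approximable h"
  unfolding approximable_def by (intro allI impI exI[of _ h] exI[of _ "Suc 0"]) simp

lemma approximable_closed:
  assumes "\<And>e. e > 0 \<Longrightarrow> \<exists>g. approximable g \<and> (\<forall>x. \<bar>g x - h x\<bar> < e)"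
  shows "approximable h"
  unfolding approximable_def
proof (intro allI impI)
  fix e :: real assume "e > 0"
  hence e: "e / 2 > 0" by simp
  obtain g where g: "approximable g" "\<And>x. \<bar>g x - h x\<bar> < e / 2" using assms[OF e] by blast
  obtain k m where k: "quasi_uniform k" "m > (0::nat)" "\<And>x. \<bar>k x / m - g x\<bar> < e / 2"
    using g(1) e unfolding approximable_def by blast
  have "\<bar>k x / m - h x\<bar> < e" for x using g(2)[of x] k(3)[of x] by linarith
  thus "\<exists>g m. quasi_uniform g \<and> m > (0::nat) \<and> (\<forall>x. \<bar>g x / m - h x\<bar> < e)" using k by blast
qed

lemma approximable_add:
  assumes "approximable h" "approximable k"
  shows "approximable (\<lambda>x. h x + k x)"
  unfolding approximable_def
proof (intro allI impI)
  fix e :: real assume "e > 0"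
  hence e: "e / 2 > 0" by simp
  obtain g m where g: "quasi_uniform g" "m > (0::nat)" "\<And>x. \<bar>g x / m - h x\<bar> < e / 2"
    using assms(1) e unfolding approximable_def by blast
  obtain g' m' where g': "quasi_uniform g'" "m' > (0::nat)" "\<And>x. \<bar>g' x / m' - k x\<bar> < e / 2"
    using assms(2) e unfolding approximable_def by blast
  have "quasi_uniform (\<lambda>x. real m' * g x + real m * g' x)"
    by (intro quasi_uniform_add quasi_uniform_of_nat_mult g g')
  moreover have "\<bar>(real m' * g x + real m * g' x) / real (m * m') - (h x + k x)\<bar> < e" for x
  proof -
    have "(real m' * g x + real m * g' x) / real (m * m') = g x / m + g' x / m'"
      using g(2) g'(2) by (simp add: field_simps)
    thus ?thesis using g(3)[of x] g'(3)[of x] by linarith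
  qed
  ultimately show "\<exists>g m. quasi_uniform g \<and> m > (0::nat) \<and> (\<forall>x. \<bar>g x / m - (h x + k x)\<bar> < e)"
    using g(2) g'(2) by (intro exI[of _ "\<lambda>x. real m' * g x + real m * g' x"] exI[of _ "m * m'"]) auto
qed

lemma approximable_scale:
  fixes h :: "'a::{finite,lattice} \<Rightarrow> real"
  assumes "approximable h" "c \<ge> 0"
  shows "approximable (\<lambda>x. c * h x)"
  unfolding approximable_def
proof (intro allI impI)
  fix e :: real assume "e > 0"
  hence e: "e / (2 * (c + 1)) > 0" using assms(2) by simp
  obtain g m where g: "quasi_uniform g" "m > (0::nat)" "\<And>x. \<bar>g x / m - h x\<bar> < e / (2 * (c + 1))"
    using assms(1) e unfolding approximable_def by blast
  define G where "G = Max (range (\<lambda>x. \<bar>g x / m\<bar>))"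
  have G: "\<bar>g x / m\<bar> \<le> G" for x unfolding G_def by (rule Max_ge) auto
  \<comment> \<open>Replacing \<open>c\<close> by a fraction \<open>a / b\<close> costs at most
    \<open>G / b\<close>, and this choice of \<open>b\<close> keeps that below
    \<open>e / 2\<close>.\<close>
  obtain b :: nat where b: "b > 0" "2 * G / e < b"
    using reals_Archimedean2[of "max 1 (2 * G / e)"] by (metis max_less_iff_conj of_nat_0_less_iff zero_less_one order_less_trans)
  define a where "a = nat \<lfloor>c * b\<rfloor>"
  have "\<bar>real a - c * b\<bar> \<le> 1" using assms(2) by (simp add: a_def) linarith
  moreover have "a / b - c = (real a - c * b) / b" using b(1) by (simp add: field_simps)
  ultimately have ab: "\<bar>a / b - c\<bar> \<le> 1 / b"
    by (simp add: abs_divide divide_right_mono)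
  have "\<bar>(real a * g x) / real (b * m) - c * h x\<bar> < e" for x
  proof -
    have "(real a * g x) / real (b * m) - c * h x = (a / b - c) * (g x / m) + c * (g x / m - h x)"
      using b(1) g(2) by (simp add: field_simps)
    moreover have "\<bar>(a / b - c) * (g x / m)\<bar> \<le> 1 / b * G"
      unfolding abs_mult using ab G by (intro mult_mono) auto
    moreover have "1 / b * G < e / 2"
      using b \<open>e > 0\<close> by (simp add: field_simps)
    moreover have "\<bar>c * (g x / m - h x)\<bar> \<le> c * (e / (2 * (c + 1)))"
      unfolding abs_mult using assms(2) g(3)[of x] by (intro mult_mono) auto
    moreover have "c * (e / (2 * (c + 1))) \<le> e / 2"
      using assms(2) \<open>e > 0\<close> by (simp add: field_simps)
    ultimately show ?thesis by linarith
  qed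
  thus "\<exists>g m. quasi_uniform g \<and> m > (0::nat) \<and> (\<forall>x. \<bar>g x / m - c * h x\<bar> < e)"
    using quasi_uniform_of_nat_mult[OF g(1), of a] b(1) g(2)
    by (intro exI[of _ "\<lambda>x. real a * g x"] exI[of _ "b * m"]) auto
qed

text \<open>Diluting \<open>k\<close> independent copies of \<open>g\<close> with probability
  \<open>1 / (k * m)\<close> gives \<open>g / m\<close> up to the coin entropy
  \<open>d (k * m)\<close>, which tends to 0 as \<open>k\<close> grows.\<close>

lemma approximable_imp_closure_entropic:
  fixes h :: "'a::{finite,lattice} \<Rightarrow> real"
  assumes "approximable h"
  shows "h \<in> closure {h. entropic h}"
  unfolding closure_fun_iff
proof (intro allI impI)
  fix e :: real assume "e > 0"
  hence e: "e / 2 > 0" by simp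
  obtain g m where g: "quasi_uniform g" "m > (0::nat)" "\<And>x. \<bar>g x / m - h x\<bar> < e / 2"
    using assms e unfolding approximable_def by blast
  define d where "d m = log 2 m / m + (real m - 1) / m * log 2 (m / (real m - 1))" for m :: nat
  have "d \<longlonglongrightarrow> 0" unfolding d_def by real_asymp
  from tendstoD[OF this e] obtain M where M: "\<And>n. n \<ge> M \<Longrightarrow> \<bar>d n\<bar> < e / 2"
    by (auto simp: eventually_sequentially dist_real_def)
  define k where "k = M + 2"
  have km: "k * m \<ge> k" using g(2) by simp
  have E: "entropic (\<lambda>x. real k * g x / real (k * m) + d (k * m))"
    unfolding d_def using km
    by (intro quasi_uniform_dilute quasi_uniform_of_nat_mult g(1)) (simp add: k_def)
  have "\<bar>(real k * g x / real (k * m) + d (k * m)) - h x\<bar> < e" for x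
  proof -
    have "k > 0" by (simp add: k_def)
    hence "real k * g x / real (k * m) = g x / m" by simp
    moreover have "\<bar>d (k * m)\<bar> < e / 2" using km by (intro M) (simp add: k_def)
    ultimately show ?thesis using g(3)[of x] by linarith
  qed
  with E show "\<exists>g\<in>{h. entropic h}. \<forall>x. \<bar>g x - h x\<bar> < e"
    by (intro bexI[of _ "\<lambda>x. real k * g x / real (k * m) + d (k * m)"]) auto
qed

section \<open>Lattices with three join-irreducible elements\<close>

text \<open>One fair bit is revealed to exactly those \<open>x\<close> with \<open>P x\<close>; by
  hypothesis a join sees it iff one of the joined elements does.\<close>

lemma approximable_step:
  fixes P :: "'a::lattice \<Rightarrow> bool"
  assumes "\<And>x y. P (sup x y) \<longleftrightarrow> P x \<or> P y"
  shows "approximable (\<lambda>x. of_bool (P x))"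
proof (intro quasi_uniform_approximable
    quasi_uniformI[of UNIV "\<lambda>x u. P x \<and> u" "\<lambda>x. if P x then 1 else 2"])
  show "join_compatible UNIV (\<lambda>x u. P x \<and> u)"
    using assms by (auto simp: join_compatible_def)
  show "card (fibre UNIV ((\<and>) (P x)) u) = (if P x then 1 else 2)" for x u
    by (auto simp: fibre_def)
qed auto

lemma approximable_const:
  "c \<ge> 0 \<Longrightarrow> approximable (\<lambda>_ :: 'a::{finite,lattice}. c)"
  using approximable_scale[OF approximable_step[of "\<lambda>_. True"], of c] by simp

lemma card_bool_pairs:
  "card {v :: bool \<times> bool. Q v} =
     of_bool (Q (False, False)) + of_bool (Q (False, True)) +
     of_bool (Q (True, False)) + of_bool (Q (True, True))"
proof -
  have "card {v :: bool \<times> bool. Q v} = (\<Sum>v\<in>UNIV. of_bool (Q v))"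
    by (simp add: of_bool_def sum.If_cases)
  also have "\<dots> = (\<Sum>a\<in>UNIV. \<Sum>b\<in>UNIV. of_bool (Q (a, b)))"
    by (simp only: sum.cartesian_product UNIV_Times_UNIV split_def prod.collapse)
  finally show ?thesis unfolding UNIV_bool by simp
qed

text \<open>Equivalently, every \<open>x\<close> is the join of those of \<open>a\<close>,
  \<open>b\<close>, \<open>c\<close> that lie below it; the order formulation avoids an empty join
  at the bottom. Repetitions cover the case of fewer generators.\<close>

locale three_generated =
  fixes a b c :: "'a::{finite,lattice}"
  assumes gen: "\<And>x z. (a \<le> x \<Longrightarrow> a \<le> z) \<Longrightarrow> (b \<le> x \<Longrightarrow> b \<le> z) \<Longrightarrow> (c \<le> x \<Longrightarrow> c \<le> z) \<Longrightarrow> x \<le> z"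
begin

text \<open>Two independent fair bits \<open>A\<close>, \<open>B\<close> and their exclusive or are
  attached to \<open>a\<close>, \<open>b\<close>, \<open>c\<close>: three vectors in general
  position in a plane over the field with two elements.\<close>

lemma approximable_rank_two:
  "approximable (\<lambda>x. min 2 (of_bool (a \<le> x) + of_bool (b \<le> x) + of_bool (c \<le> x)))"
proof -
  define F where "F x = (\<lambda>(A, B). (a \<le> x \<and> A, b \<le> x \<and> B, c \<le> x \<and> (A \<noteq> B)))" for x
  define k :: "'a \<Rightarrow> nat" where
    "k x = 4 div 2 ^ min 2 (of_bool (a \<le> x) + of_bool (b \<le> x) + of_bool (c \<le> x))" for x
  have mono: "F x u = F x v" if "F y u = F y v" "x \<le> y" for x y u v
    using that by (cases u; cases v) (auto simp: F_def dest: order_trans)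
  have join: "F (sup x y) u = F (sup x y) v" if eq: "F x u = F x v" "F y u = F y v" for x y u v
  proof -
    consider "x \<le> y" | "y \<le> x" | "\<not> x \<le> y" "\<not> y \<le> x" by blast
    thus ?thesis
    proof cases
      case 1 thus ?thesis using eq by (simp add: sup_absorb2)
    next
      case 2 thus ?thesis using eq by (simp add: sup_absorb1)
    next
      case 3
      obtain A B A' B' where uv: "u = (A, B)" "v = (A', B')" by (cases u; cases v)
      \<comment> \<open>Each of \<open>x\<close>, \<open>y\<close> lies above a generator that the
        other misses, so together they see two of the three bits, hence both \<open>A\<close> and
        \<open>B\<close>.\<close>
      have "(a \<le> x \<and> \<not> a \<le> y) \<or> (b \<le> x \<and> \<not> b \<le> y) \<or> (c \<le> x \<and> \<not> c \<le> y)"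
        using 3(1) gen[of x y] by blast
      moreover have "(a \<le> y \<and> \<not> a \<le> x) \<or> (b \<le> y \<and> \<not> b \<le> x) \<or> (c \<le> y \<and> \<not> c \<le> x)"
        using 3(2) gen[of y x] by blast
      moreover have "(a \<le> x \<longrightarrow> A = A') \<and> (b \<le> x \<longrightarrow> B = B') \<and> (c \<le> x \<longrightarrow> (A = B) = (A' = B'))"
        using eq(1) unfolding F_def uv by fastforce
      moreover have "(a \<le> y \<longrightarrow> A = A') \<and> (b \<le> y \<longrightarrow> B = B') \<and> (c \<le> y \<longrightarrow> (A = B) = (A' = B'))"
        using eq(2) unfolding F_def uv by fastforce
      ultimately have "A = A' \<and> B = B'" by argo
      thus ?thesis by (simp add: uv)
    qed
  qed
  have "quasi_uniform (\<lambda>x. min 2 (of_bool (a \<le> x) + of_bool (b \<le> x) + of_bool (c \<le> x)))"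
  proof (rule quasi_uniformI[of UNIV F k])
    show "join_compatible UNIV F"
      unfolding join_compatible_def
      by (intro allI ballI iffI conjI; (elim conjE)?; (rule join; assumption)?)
         (erule mono, simp)+
    fix x
    show "card (fibre UNIV (F x) u) = k x" for u
      by (cases u; cases "a \<le> x"; cases "b \<le> x"; cases "c \<le> x")
         (auto simp: fibre_def card_bool_pairs F_def k_def)
    have "log 2 (4::real) = 2" using log_pow_cancel[of 2 2] by simp
    thus "min 2 (of_bool (a \<le> x) + of_bool (b \<le> x) + of_bool (c \<le> x)) =
        log 2 (card (UNIV :: (bool \<times> bool) set) / real (k x))"
      by (cases "a \<le> x"; cases "b \<le> x"; cases "c \<le> x")
         (auto simp: k_def card_prod)
  qed auto
  thus ?thesis by (rule quasi_uniform_approximable)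
qed

text \<open>An element above neither \<open>a\<close> nor \<open>b\<close> is determined by whether
  it lies above \<open>c\<close>. Two such elements are comparable, and their join is one of
  them.\<close>

lemma approximable_two_steps:
  "approximable (\<lambda>x. of_bool (a \<le> x \<or> b \<le> x))"
proof (rule approximable_step)
  fix x y
  show "(a \<le> sup x y \<or> b \<le> sup x y) \<longleftrightarrow> (a \<le> x \<or> b \<le> x) \<or> a \<le> y \<or> b \<le> y"
  proof (rule iffI, rule ccontr)
    assume *: "a \<le> sup x y \<or> b \<le> sup x y" "\<not> ((a \<le> x \<or> b \<le> x) \<or> a \<le> y \<or> b \<le> y)"
    hence "x \<le> y \<or> y \<le> x" using gen[of x y] gen[of y x] by blast
    thus False using * by (auto simp: sup_absorb1 sup_absorb2)
  qed (auto intro: le_supI1 le_supI2)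
qed

text \<open>If \<open>a \<le> sup b c\<close>, the coefficient vanishes. Otherwise \<open>a\<close>
  is join-prime: elements not above \<open>a\<close> lie below \<open>sup b c\<close>, and so do
  their joins.\<close>

lemma approximable_one_step:
  assumes "polymatroid h"
  shows "approximable (\<lambda>x. (h (sup a (sup b c)) - h (sup b c)) * of_bool (a \<le> x))"
proof (cases "a \<le> sup b c")
  case True
  hence "sup a (sup b c) = sup b c" by (simp add: sup_absorb2)
  thus ?thesis using approximable_const[of 0] by simp
next
  case False
  have "approximable (\<lambda>x. of_bool (a \<le> x))"
  proof (rule approximable_step)
    fix x y
    show "a \<le> sup x y \<longleftrightarrow> a \<le> x \<or> a \<le> y"
    proof (rule iffI, rule ccontr)
      assume *: "a \<le> sup x y" "\<not> (a \<le> x \<or> a \<le> y)"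
      have "x \<le> sup b c" by (rule gen) (use * in auto)
      moreover have "y \<le> sup b c" by (rule gen) (use * in auto)
      ultimately show False using * False order_trans[OF *(1), of "sup b c"] by simp
    qed (auto intro: le_supI1 le_supI2)
  qed
  moreover have "h (sup b c) \<le> h (sup a (sup b c))"
    using assms by (simp add: polymatroid_def)
  ultimately show ?thesis by (intro approximable_scale) auto
qed

end

text \<open>The coefficients are the atoms of the I-measure of \<open>a, b, c\<close>. Only the triple atom can be
  negative; it is then traded for the rank function of three vectors in general position in a plane.
  A step function that is not compatible with joins occurs with coefficient 0.\<close>

lemma (in three_generated) polymatroid_approximable:
  fixes h :: "'a \<Rightarrow> real"
  assumes h: "polymatroid h"
  shows "approximable h"
proof -
  interpret bac: three_generated b a c by unfold_locales (blast intro: gen)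
  interpret cab: three_generated c a b by unfold_locales (blast intro: gen)
  interpret acb: three_generated a c b by unfold_locales (blast intro: gen)
  interpret bca: three_generated b c a by unfold_locales (blast intro: gen)
  define z where "z = Inf_fin (UNIV :: 'a set)"
  have z: "z \<le> x" for x by (simp add: z_def Inf_fin.coboundedI)
  have mono: "h x \<le> h y" if "x \<le> y" for x y using h that by (simp add: polymatroid_def)
  \<comment> \<open>Any common lower bound \<open>w\<close> may replace the meet:
    \<open>inf (sup a c) (sup b c)\<close>, for instance, may lie strictly above
    \<open>c\<close>.\<close>
  have sub: "h (sup x y) + h w \<le> h x + h y" if "w \<le> x" "w \<le> y" for x y w
  proof -
    have "h w \<le> h (inf x y)" using that by (intro mono) auto
    thus ?thesis using h by (smt (verit) polymatroid_def)
  qed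
  define T where "T = h (sup a (sup b c))"
  \<comment> \<open>Relative to the value \<open>h z\<close> at the bottom, \<open>i\<close> is the
    interaction information of the three generators; \<open>ab\<close> is the mutual information of
    \<open>a\<close> and \<open>b\<close> given \<open>c\<close>, and likewise for \<open>ac\<close>
    and \<open>bc\<close>.\<close>
  define i where "i = h a + h b + h c - h (sup a b) - h (sup a c) - h (sup b c) + T - h z"
  define ab where "ab = h (sup a c) + h (sup b c) - T - h c"
  define ac where "ac = h (sup a b) + h (sup b c) - T - h b"
  define bc where "bc = h (sup a b) + h (sup a c) - T - h a"
  let ?A = "\<lambda>x. of_bool (a \<le> x) :: real" and ?B = "\<lambda>x. of_bool (b \<le> x) :: real"
    and ?C = "\<lambda>x. of_bool (c \<le> x) :: real"
    and ?AB = "\<lambda>x. of_bool (a \<le> x \<or> b \<le> x) :: real" and ?AC = "\<lambda>x. of_bool (a \<le> x \<or> c \<le> x) :: real"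
    and ?BC = "\<lambda>x. of_bool (b \<le> x \<or> c \<le> x) :: real"
    and ?ABC = "\<lambda>x. of_bool (a \<le> x \<or> b \<le> x \<or> c \<le> x) :: real"
  have perm: "sup b (sup a c) = sup a (sup b c)" "sup c (sup a b) = sup a (sup b c)"
    by (simp_all add: ac_simps)
  have "approximable (\<lambda>x. h z + ((T - h (sup b c)) * ?A x + ((T - h (sup a c)) * ?B x + (T - h (sup a b)) * ?C x)))"
    using approximable_one_step[OF h] bac.approximable_one_step[OF h] cab.approximable_one_step[OF h] h
    unfolding T_def perm by (intro approximable_add approximable_const) (auto simp: polymatroid_def)
  note ones = this
  have twos: "approximable (\<lambda>x. p * ?AB x + (q * ?AC x + r * ?BC x))"
    if "p \<ge> 0" "q \<ge> 0" "r \<ge> 0" for p q r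
    using that by (intro approximable_add approximable_scale approximable_two_steps
        acb.approximable_two_steps bca.approximable_two_steps)
  have decomp: "h x = (h z + ((T - h (sup b c)) * ?A x + ((T - h (sup a c)) * ?B x + (T - h (sup a b)) * ?C x)))
      + (ab * ?AB x + (ac * ?AC x + bc * ?BC x)) + i * ?ABC x" for x
  proof -
    have x: "x = w" if "w \<le> x" "(a \<le> x \<Longrightarrow> a \<le> w)" "(b \<le> x \<Longrightarrow> b \<le> w)" "(c \<le> x \<Longrightarrow> c \<le> w)" for w
      using that gen[of x w] by (simp add: order_antisym)
    consider "x = z" "\<not> a \<le> x" "\<not> b \<le> x" "\<not> c \<le> x"
      | "x = a" "a \<le> x" "\<not> b \<le> x" "\<not> c \<le> x" | "x = b" "\<not> a \<le> x" "b \<le> x" "\<not> c \<le> x"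
      | "x = c" "\<not> a \<le> x" "\<not> b \<le> x" "c \<le> x" | "x = sup a b" "a \<le> x" "b \<le> x" "\<not> c \<le> x"
      | "x = sup a c" "a \<le> x" "\<not> b \<le> x" "c \<le> x" | "x = sup b c" "\<not> a \<le> x" "b \<le> x" "c \<le> x"
      | "x = sup a (sup b c)" "a \<le> x" "b \<le> x" "c \<le> x"
      using x[of z] x[of a] x[of b] x[of c] x[of "sup a b"] x[of "sup a c"] x[of "sup b c"]
        x[of "sup a (sup b c)"] z
      by (cases "a \<le> x"; cases "b \<le> x"; cases "c \<le> x") (simp_all add: le_supI1 le_supI2)
    thus ?thesis
    proof cases
    qed (simp_all only: T_def i_def ab_def ac_def bc_def of_bool_eq simp_thms, simp_all)
  qed
  have nn: "ab \<ge> 0" "ac \<ge> 0" "bc \<ge> 0"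
    using sub[of c "sup a c" "sup b c"] sub[of b "sup a b" "sup b c"] sub[of a "sup a b" "sup a c"]
    by (simp_all add: ab_def ac_def bc_def T_def ac_simps)
  show ?thesis
  proof (cases "i \<ge> 0")
    case True
    have "approximable ?ABC"
    proof (rule approximable_step)
      fix x y
      have "x \<le> y" if "\<not> a \<le> x" "\<not> b \<le> x" "\<not> c \<le> x" by (rule gen) (use that in auto)
      thus "(a \<le> sup x y \<or> b \<le> sup x y \<or> c \<le> sup x y) \<longleftrightarrow>
          (a \<le> x \<or> b \<le> x \<or> c \<le> x) \<or> (a \<le> y \<or> b \<le> y \<or> c \<le> y)"
        by (auto simp: sup_absorb2 intro: le_supI1 le_supI2)
    qed
    from approximable_add[OF approximable_add[OF ones twos[OF nn]] approximable_scale[OF this True]]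
    show ?thesis unfolding decomp[symmetric] .
  next
    case False
    \<comment> \<open>\<open>ab + i\<close> equals \<open>h a + h b - h (sup a b) - h z\<close>, the
      unconditional mutual information of \<open>a\<close> and \<open>b\<close>.\<close>
    have "ab + i \<ge> 0" "ac + i \<ge> 0" "bc + i \<ge> 0"
      using sub[of z a b] sub[of z a c] sub[of z b c] z
      by (simp_all add: ab_def ac_def bc_def i_def)
    note two = twos[OF this]
    \<comment> \<open>With 0, 1, 2 or 3 generators below \<open>x\<close> this reads 0 = 0, 1 = 2 -
      1, 1 = 3 - 2, 1 = 3 - 2. It turns the negative multiple of \<open>?ABC\<close> into a positive
      multiple of the rank function and adds \<open>i\<close> to each pairwise coefficient.\<close>
    have "?ABC x = ?AB x + ?AC x + ?BC x - min 2 (?A x + ?B x + ?C x)" for x by auto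
    hence "h x = (h z + ((T - h (sup b c)) * ?A x + ((T - h (sup a c)) * ?B x + (T - h (sup a b)) * ?C x)))
      + ((ab + i) * ?AB x + ((ac + i) * ?AC x + (bc + i) * ?BC x))
      + (- i) * min 2 (?A x + ?B x + ?C x)" for x
      by (subst decomp) (simp add: algebra_simps del: of_bool_or_iff)
    hence eq: "h = (\<lambda>x. (h z + ((T - h (sup b c)) * ?A x + ((T - h (sup a c)) * ?B x + (T - h (sup a b)) * ?C x)))
      + ((ab + i) * ?AB x + ((ac + i) * ?AC x + (bc + i) * ?BC x))
      + (- i) * min 2 (?A x + ?B x + ?C x))" by (rule ext)
    have "- i \<ge> 0" using False by simp
    from approximable_add[OF approximable_add[OF ones two] approximable_scale[OF approximable_rank_two this]]
    show ?thesis unfolding eq[symmetric] .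
  qed
qed

section \<open>Linear forms in general position over a prime field\<close>

locale prime_vectors =
  fixes p N :: nat
  assumes p: "prime p"
begin

text \<open>The space of dimension \<open>N\<close> over the field with \<open>p\<close> elements.
  Reduced residues and zeros beyond \<open>N\<close> give each vector one representing function, so
  cardinalities count vectors.\<close>

definition vecs :: "(nat \<Rightarrow> int) set" where
  "vecs = PiE_dflt {..<N} 0 (\<lambda>_. {0..<int p})"

definition comb :: "(nat \<Rightarrow> int) \<Rightarrow> int \<Rightarrow> (nat \<Rightarrow> int) \<Rightarrow> nat \<Rightarrow> int" where
  "comb u k v = (\<lambda>i. (u i + k * v i) mod int p)"

definition form :: "(nat \<Rightarrow> int) \<Rightarrow> (nat \<Rightarrow> int) \<Rightarrow> int" where
  "form a u = (\<Sum>i<N. a i * u i) mod int p"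

text \<open>Replaces bases: a set of forms has rank \<open>r\<close> when its common kernel has
  \<open>p ^ (N - r)\<close> elements.\<close>

definition kernel :: "('e \<Rightarrow> nat \<Rightarrow> int) \<Rightarrow> 'e set \<Rightarrow> (nat \<Rightarrow> int) set" where
  "kernel \<phi> S = {u \<in> vecs. \<forall>e\<in>S. form (\<phi> e) u = 0}"

lemma p_gt_1: "p > 1" using p by (rule prime_gt_1_nat)

lemma finite_vecs: "finite vecs"
  by (simp add: vecs_def finite_PiE_dflt)

lemma card_vecs: "card vecs = p ^ N"
  by (simp add: vecs_def card_PiE_dflt)

lemma vecs_mod: "u \<in> vecs \<Longrightarrow> u i mod int p = u i"
  using p_gt_1 by (cases "i < N") (auto simp: vecs_def PiE_dflt_def)

lemma comb_vecs: "u \<in> vecs \<Longrightarrow> v \<in> vecs \<Longrightarrow> comb u k v \<in> vecs"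
  using p_gt_1 by (auto simp: vecs_def PiE_dflt_def comb_def)

lemma comb_cancel: "u \<in> vecs \<Longrightarrow> comb (comb u k v) (- k) v = u"
  by (auto simp: comb_def mod_simps fun_eq_iff vecs_mod)

lemma form_range: "form a u \<in> {0..<int p}"
  using p_gt_1 by (simp add: form_def)

lemma form_comb: "form a (comb u k v) = (form a u + k * form a v) mod int p"
proof -
  have "form a (comb u k v) = (\<Sum>i<N. (a i * (u i + k * v i)) mod int p) mod int p"
    unfolding form_def comb_def
    by (subst mod_sum_eq[symmetric]) (simp add: mod_mult_right_eq)
  also have "\<dots> = (\<Sum>i<N. a i * (u i + k * v i)) mod int p"
    by (rule mod_sum_eq)
  also have "(\<Sum>i<N. a i * (u i + k * v i)) = (\<Sum>i<N. a i * u i) + k * (\<Sum>i<N. a i * v i)"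
    by (simp add: sum.distrib sum_distrib_left algebra_simps)
  also have "\<dots> mod int p = ((\<Sum>i<N. a i * u i) mod int p + k * (\<Sum>i<N. a i * v i) mod int p) mod int p"
    by (rule mod_add_eq[symmetric])
  also have "\<dots> = (form a u + k * form a v) mod int p"
    unfolding form_def mod_mult_right_eq[of k "\<Sum>i<N. a i * v i", symmetric] by (rule mod_add_right_eq)
  finally show ?thesis .
qed

lemma kernel_comb: "u \<in> kernel \<phi> S \<Longrightarrow> v \<in> kernel \<phi> S \<Longrightarrow> comb u k v \<in> kernel \<phi> S"
  by (simp add: kernel_def comb_vecs form_comb)

lemma mult_mod_eq_0_iff: "(x * y) mod int p = 0 \<longleftrightarrow> x mod int p = 0 \<or> y mod int p = 0" for x y :: int
  using p by (simp add: prime_dvd_mult_iff mod_eq_0_iff_dvd)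

text \<open>A subspace is the direct sum of the kernel of \<open>a\<close> in it and the line
  through a vector on which \<open>a\<close> is 1.\<close>

lemma card_form_kernel:
  assumes K: "K \<subseteq> vecs" "\<And>u k v. u \<in> K \<Longrightarrow> v \<in> K \<Longrightarrow> comb u k v \<in> K"
    and v0: "v\<^sub>0 \<in> K" "form a v\<^sub>0 \<noteq> 0"
  shows "card K = p * card {u \<in> K. form a u = 0}"
proof -
  have "\<not> int p dvd form a v\<^sub>0"
    using v0(2) form_range[of a "v\<^sub>0"] zdvd_not_zless[of "form a v\<^sub>0" "int p"] by auto
  hence "coprime (form a v\<^sub>0) (int p)"
    using p by (simp add: prime_imp_coprime coprime_commute)
  then obtain s where s: "[form a v\<^sub>0 * s = 1] (mod int p)"
    using cong_solve_coprime_int by blast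
  \<comment> \<open>The combination is \<open>s\<close> times \<open>v\<^sub>0\<close>, scaled so
    that the form takes the value 1.\<close>
  define v where "v = comb v\<^sub>0 (s - 1) v\<^sub>0"
  have vK: "v \<in> K" unfolding v_def by (intro K v0)
  have v: "form a v = 1"
    using s p_gt_1 by (simp add: v_def form_comb cong_def algebra_simps)
  have "bij_betw (\<lambda>(u, t). comb u t v) ({u \<in> K. form a u = 0} \<times> {0..<int p}) K"
  proof (rule bij_betw_byWitness[where f' = "\<lambda>u. (comb u (- form a u) v, form a u)"])
    have ft: "form a (comb u t v) = t" if "form a u = 0" "t \<in> {0..<int p}" for u t
      using that by (simp add: form_comb v)
    show "\<forall>x\<in>{u \<in> K. form a u = 0} \<times> {0..<int p}.
        (\<lambda>u. (comb u (- form a u) v, form a u)) ((\<lambda>(u, t). comb u t v) x) = x"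
      using K(1) by (auto simp: ft comb_cancel)
    show "\<forall>u\<in>K. (\<lambda>(u, t). comb u t v) (comb u (- form a u) v, form a u) = u"
      using K(1) comb_cancel[of _ "- form a _" v] by auto
    show "(\<lambda>(u, t). comb u t v) ` ({u \<in> K. form a u = 0} \<times> {0..<int p}) \<subseteq> K"
      using K(2) vK by auto
    show "(\<lambda>u. (comb u (- form a u) v, form a u)) ` K \<subseteq> {u \<in> K. form a u = 0} \<times> {0..<int p}"
      using K(2) vK form_range[of a] by (auto simp: form_comb v)
  qed
  from bij_betw_same_card[OF this] show ?thesis
    by (simp add: card_cartesian_product mult.commute)
qed

text \<open>Induction on \<open>B\<close>: for a new \<open>u\<close> with
  \<open>u j \<noteq> 0\<close> only the \<open>j\<close>-th coefficient is shifted. Each vector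
  excludes at most one of the \<open>p\<close> shifts, and there are fewer than \<open>p\<close>
  vectors.\<close>

lemma exists_form_nonzero:
  assumes "finite B" "B \<subseteq> vecs" "\<And>u. u \<in> B \<Longrightarrow> \<exists>i<w. u i \<noteq> 0" "w \<le> N" "card B < p"
  shows "\<exists>a. (\<forall>i\<ge>w. a i = 0) \<and> (\<forall>u\<in>B. form a u \<noteq> 0)"
  using assms
proof (induction B rule: finite_induct)
  case empty
  thus ?case by (intro exI[of _ "\<lambda>_. 0"]) simp
next
  case (insert u B)
  then obtain a where a: "\<forall>i\<ge>w. a i = 0" "\<forall>u\<in>B. form a u \<noteq> 0" by auto
  obtain j where j: "j < w" "u j \<noteq> 0" using insert.prems(2)[of u] by blast
  have jN: "j < N" using j insert.prems by simp
  define b where "b t = a(j := a j + t)" for t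
  have form_b: "form (b t) v = (form a v + t * v j) mod int p" for t v
  proof -
    have "(\<Sum>i<N. b t i * v i) = (\<Sum>i<N. a i * v i + (if i = j then t * v i else 0))"
      by (rule sum.cong) (auto simp: b_def algebra_simps)
    also have "\<dots> = (\<Sum>i<N. a i * v i) + t * v j"
      using jN by (simp add: sum.distrib)
    finally show ?thesis by (simp add: form_def mod_simps)
  qed
  define bad where "bad v = {t \<in> {0..<int p}. form (b t) v = 0}" for v
  have bad: "card (bad v) \<le> 1" if v: "v \<in> insert u B" for v
  proof (cases "v j = 0")
    case True
    hence "v \<in> B" using v j by auto
    hence "bad v = {}"
      using a(2) True form_range[of a v] by (auto simp: bad_def form_b)
    thus ?thesis by simp
  next
    case False
    have nz: "v j mod int p \<noteq> 0" using False vecs_mod[of v j] v insert.prems(1) by auto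
    have "t = t'" if t: "t \<in> bad v" "t' \<in> bad v" for t t'
    proof -
      have "int p dvd (form a v + t * v j) - (form a v + t' * v j)"
        using t by (intro dvd_diff) (auto simp: bad_def form_b mod_eq_0_iff_dvd)
      hence "((t - t') * v j) mod int p = 0" by (simp add: algebra_simps mod_eq_0_iff_dvd)
      hence "(t - t') mod int p = 0" using nz by (simp add: mult_mod_eq_0_iff)
      hence "t mod int p = t' mod int p" by (simp add: mod_eq_dvd_iff mod_eq_0_iff_dvd)
      thus ?thesis using t by (simp add: bad_def)
    qed
    moreover have "finite (bad v)"
      by (rule finite_subset[of _ "{0..<int p}"]) (auto simp: bad_def)
    ultimately show ?thesis using card_le_Suc0_iff_eq[of "bad v"] by auto
  qed
  have fin: "finite (insert u B)" using insert.hyps by simp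
  have "card (\<Union>v\<in>insert u B. bad v) \<le> (\<Sum>v\<in>insert u B. card (bad v))"
    by (rule card_UN_le[OF fin])
  also have "\<dots> \<le> (\<Sum>v\<in>insert u B. 1)" by (rule sum_mono) (rule bad)
  also have "\<dots> < card {0..<int p}" using insert.prems(4) by simp
  finally have "(\<Union>v\<in>insert u B. bad v) \<noteq> {0..<int p}" by auto
  moreover have "(\<Union>v\<in>insert u B. bad v) \<subseteq> {0..<int p}" by (auto simp: bad_def)
  ultimately obtain t where "t \<in> {0..<int p}" "t \<notin> (\<Union>v\<in>insert u B. bad v)" by blast
  hence "\<forall>v\<in>insert u B. form (b t) v \<noteq> 0" by (auto simp: bad_def)
  moreover have "\<forall>i\<ge>w. b t i = 0" using a(1) j(1) by (auto simp: b_def)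
  ultimately show ?case by blast
qed

text \<open>Forms are chosen one by one in order of increasing level, a form of level \<open>l\<close> using only
  the first \<open>w l\<close> coordinates and otherwise being in general position: it is non-zero on one chosen
  vector from each earlier common kernel on which this is not excluded.\<close>

lemma generic_forms:
  fixes lev :: "'e \<Rightarrow> nat" and w :: "nat \<Rightarrow> nat"
  assumes "finite E" and w: "mono w" "\<And>l. w l \<le> N" and "2 ^ card E < p"
  shows "\<exists>\<phi> r. (\<forall>e\<in>E. \<forall>i\<ge>w (lev e). \<phi> e i = 0) \<and>
    (\<forall>S\<subseteq>E. r S \<le> N \<and> card (kernel \<phi> S) = p ^ (N - r S)) \<and> r {} = 0 \<and>
    (\<forall>S\<subseteq>E. \<forall>l. (\<forall>e\<in>S. lev e \<le> l) \<longrightarrow>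
       r S = min (w l) (r {e \<in> S. lev e < l} + card {e \<in> S. lev e = l}))"
  using assms(1,4)
proof (induction E rule: finite_ranking_induct[where f = lev])
  case empty
  show ?case
    by (intro exI[of _ "\<lambda>_ _. 0"] exI[of _ "\<lambda>_. 0"]) (auto simp: kernel_def card_vecs)
next
  case (insert e E)
  show ?case
  proof (cases "e \<in> E")
    case True
    thus ?thesis using insert.IH insert.prems by (simp add: insert_absorb)
  next
    case e: False
    have cE: "2 ^ card E < p" using insert.prems insert.hyps(1) e by simp
    obtain \<phi> r where supp: "\<forall>e\<in>E. \<forall>i\<ge>w (lev e). \<phi> e i = 0"
      and rank: "\<forall>S\<subseteq>E. r S \<le> N \<and> card (kernel \<phi> S) = p ^ (N - r S)"
      and r0: "r {} = 0"
      and rec: "\<forall>S\<subseteq>E. \<forall>l. (\<forall>e\<in>S. lev e \<le> l) \<longrightarrow>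
       r S = min (w l) (r {e \<in> S. lev e < l} + card {e \<in> S. lev e = l})"
      using insert.IH[OF cE] by (elim exE conjE)
    define W where "W = w (lev e)"
    have WN: "W \<le> N" by (simp add: W_def w)
    \<comment> \<open>The vectors that vanish in the first \<open>W\<close> coordinates. As
      \<open>e\<close> has the highest level, all forms chosen so far are zero on \<open>Z\<close>,
      so \<open>Z\<close> lies in each of their kernels.\<close>
    define Z where "Z = PiE_dflt {W..<N} 0 (\<lambda>_. {0..<int p})"
    have cZ: "card Z = p ^ (N - W)" by (simp add: Z_def card_PiE_dflt)
    have Z: "u \<in> Z \<longleftrightarrow> u \<in> vecs \<and> (\<forall>i<W. u i = 0)" for u
    proof -
      have "(i < N \<longrightarrow> u i \<in> {0..<int p}) \<and> (\<not> i < N \<longrightarrow> u i = 0) \<and> (i < W \<longrightarrow> u i = 0) \<longleftrightarrow>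
          (i \<in> {W..<N} \<longrightarrow> u i \<in> {0..<int p}) \<and> (i \<notin> {W..<N} \<longrightarrow> u i = 0)" for i
        using p_gt_1 WN by auto
      thus ?thesis unfolding Z_def vecs_def PiE_dflt_def mem_Collect_eq lessThan_iff by meson
    qed
    have form_Z: "form a u = 0" if "u \<in> Z" "\<forall>i\<ge>W. a i = 0" for a u
    proof -
      have "a i * u i = 0" for i using that by (cases "i < W") (auto simp: Z)
      hence "(\<Sum>i<N. a i * u i) = 0" by (intro sum.neutral) simp
      thus ?thesis by (simp add: form_def)
    qed
    have Z_sub: "Z \<subseteq> kernel \<phi> S" if "S \<subseteq> E" for S
    proof
      fix u assume u: "u \<in> Z"
      have "form (\<phi> e') u = 0" if "e' \<in> S" for e'
      proof (rule form_Z[OF u])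
        have "e' \<in> E" using that \<open>S \<subseteq> E\<close> by blast
        moreover from this have "w (lev e') \<le> W" unfolding W_def
          using insert.hyps(2) by (intro monoD[OF w(1)]) auto
        ultimately show "\<forall>i\<ge>W. \<phi> e' i = 0" using supp by auto
      qed
      thus "u \<in> kernel \<phi> S" using u by (simp add: kernel_def Z)
    qed
    have fker: "finite (kernel \<phi> S)" for S
      by (rule finite_subset[OF _ finite_vecs]) (auto simp: kernel_def)
    \<comment> \<open>The sets whose kernel is larger than \<open>Z\<close>, where the new form can
      be non-zero. There are at most \<open>2 ^ card E\<close> of them, hence the bound on
      \<open>p\<close>.\<close>
    define \<S> where "\<S> = {S. S \<subseteq> E \<and> r S < W}"
    have "\<exists>u. u \<in> kernel \<phi> S \<and> u \<notin> Z" if "S \<in> \<S>" for S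
    proof (rule ccontr)
      assume "\<nexists>u. u \<in> kernel \<phi> S \<and> u \<notin> Z"
      hence "kernel \<phi> S \<subseteq> Z" by blast
      hence "card (kernel \<phi> S) \<le> card Z"
        by (intro card_mono) (auto simp: Z_def finite_PiE_dflt)
      moreover have "p ^ (N - W) < p ^ (N - r S)"
        using that p_gt_1 WN by (intro power_strict_increasing) (auto simp: \<S>_def)
      ultimately show False using rank that by (auto simp: cZ \<S>_def)
    qed
    then obtain f where f: "\<And>S. S \<in> \<S> \<Longrightarrow> f S \<in> kernel \<phi> S \<and> f S \<notin> Z" by metis
    have fin\<S>: "finite \<S>" and card\<S>: "card \<S> \<le> 2 ^ card E"
      using insert.hyps(1) card_mono[of "Pow E" \<S>] finite_subset[of \<S> "Pow E"]
      by (auto simp: \<S>_def card_Pow)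
    have "\<exists>a. (\<forall>i\<ge>W. a i = 0) \<and> (\<forall>u\<in>f ` \<S>. form a u \<noteq> 0)"
    proof (rule exists_form_nonzero)
      show "f ` \<S> \<subseteq> vecs" using f by (auto simp: kernel_def)
      show "\<exists>i<W. u i \<noteq> 0" if "u \<in> f ` \<S>" for u
        using that f by (auto simp: Z kernel_def)
      show "card (f ` \<S>) < p" using card_image_le[OF fin\<S>, of f] card\<S> cE by linarith
    qed (use fin\<S> WN in auto)
    then obtain a where a: "\<forall>i\<ge>W. a i = 0" "\<And>S. S \<in> \<S> \<Longrightarrow> form a (f S) \<noteq> 0" by blast
    define \<phi>' where "\<phi>' = \<phi>(e := a)"
    \<comment> \<open>The new form raises a rank by one until the width \<open>W\<close> is
      reached.\<close>
    define r' where "r' S = (if e \<in> S then min W (r (S - {e}) + 1) else r S)" for S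
    have ker_old: "kernel \<phi>' S = kernel \<phi> S" if "e \<notin> S" for S
      using that by (auto simp: kernel_def \<phi>'_def)
    have ker_new: "kernel \<phi>' S = {u \<in> kernel \<phi> (S - {e}). form a u = 0}" if "e \<in> S" for S
      using that by (auto simp: kernel_def \<phi>'_def)
    have rank': "r' S \<le> N \<and> card (kernel \<phi>' S) = p ^ (N - r' S)" if S: "S \<subseteq> insert e E" for S
    proof (cases "e \<in> S")
      case False
      hence "S \<subseteq> E" using S by blast
      thus ?thesis using False rank by (simp add: r'_def ker_old)
    next
      case True
      define S\<^sub>0 where "S\<^sub>0 = S - {e}"
      have S0: "S\<^sub>0 \<subseteq> E" using S by (auto simp: S\<^sub>0_def)
      have r': "r' S = min W (r S\<^sub>0 + 1)" using True by (simp add: r'_def S\<^sub>0_def)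
      have k: "kernel \<phi>' S = {u \<in> kernel \<phi> S\<^sub>0. form a u = 0}"
        using ker_new[OF True] by (simp add: S\<^sub>0_def)
      show ?thesis
      proof (cases "r S\<^sub>0 < W")
        case True
        hence "S\<^sub>0 \<in> \<S>" using S0 by (simp add: \<S>_def)
        hence "card (kernel \<phi> S\<^sub>0) = p * card (kernel \<phi>' S)"
          unfolding k using f a(2)
          by (intro card_form_kernel[of _ "f S\<^sub>0"] kernel_comb) (auto simp: kernel_def)
        moreover have "N - r S\<^sub>0 = Suc (N - (r S\<^sub>0 + 1))" using True WN by simp
        ultimately have "p * card (kernel \<phi>' S) = p * p ^ (N - (r S\<^sub>0 + 1))"
          using rank S0 by (metis power_Suc)
        thus ?thesis using True WN p_gt_1 by (simp add: r')
      next
        case False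
        \<comment> \<open>At rank \<open>W\<close> or more the kernel is no larger than its subset
          \<open>Z\<close>, so it is \<open>Z\<close>, where the new form vanishes.\<close>
        have "card (kernel \<phi> S\<^sub>0) \<le> card Z"
          using rank S0 False p_gt_1 by (simp add: cZ power_increasing)
        hence "kernel \<phi> S\<^sub>0 = Z"
          using card_seteq[OF fker Z_sub[OF S0]] by simp
        hence "kernel \<phi>' S = Z" using form_Z a(1) by (auto simp: k)
        thus ?thesis using False WN by (simp add: r' cZ)
      qed
    qed
    have rec': "r' S = min (w l) (r' {e \<in> S. lev e < l} + card {e \<in> S. lev e = l})"
      if S: "S \<subseteq> insert e E" and l: "\<forall>e\<in>S. lev e \<le> l" for S l
    proof (cases "e \<in> S")
      case False
      hence "S \<subseteq> E" using S by blast
      thus ?thesis using False rec l by (simp add: r'_def)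
    next
      case True
      define S\<^sub>0 where "S\<^sub>0 = S - {e}"
      have S0: "S\<^sub>0 \<subseteq> E" "e \<notin> S\<^sub>0" "S = insert e S\<^sub>0" using S True by (auto simp: S\<^sub>0_def)
      have fS: "finite S\<^sub>0" using S0(1) insert.hyps(1) by (rule finite_subset)
      have r': "r' S = min W (r S\<^sub>0 + 1)" using True by (simp add: r'_def S\<^sub>0_def)
      have le: "lev e' \<le> lev e" if "e' \<in> S" for e'
        using that S insert.hyps(2) by auto
      show ?thesis
      proof (cases "l = lev e")
        case True
        have "r S\<^sub>0 = min W (r {e' \<in> S\<^sub>0. lev e' < l} + card {e' \<in> S\<^sub>0. lev e' = l})"
          using rec[rule_format, OF S0(1), of l] le S0(3) by (simp add: W_def True)
        moreover have "{e' \<in> S. lev e' < l} = {e' \<in> S\<^sub>0. lev e' < l}"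
          using True S0 by auto
        moreover have "r' {e' \<in> S\<^sub>0. lev e' < l} = r {e' \<in> S\<^sub>0. lev e' < l}"
          using S0(2) by (simp add: r'_def)
        moreover have "{e' \<in> S. lev e' = l} = insert e {e' \<in> S\<^sub>0. lev e' = l}"
          using True S0 by auto
        ultimately show ?thesis using True S0(2) fS by (simp add: r' W_def)
      next
        case False
        hence ll: "lev e < l" using l True by (simp add: le_neq_implies_less)
        have eqs: "{e' \<in> S. lev e' < l} = S" "{e' \<in> S. lev e' = l} = {}"
          using order_le_less_trans[OF le ll] by blast+
        have "r' S \<le> w l"
          using monoD[OF w(1), of "lev e" l] ll by (simp add: r' W_def min.coboundedI1)
        thus ?thesis unfolding eqs by simp
      qed
    qed
    have "\<forall>e'\<in>insert e E. \<forall>i\<ge>w (lev e'). \<phi>' e' i = 0"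
      using a(1) supp by (auto simp: \<phi>'_def W_def)
    moreover have "r' {} = 0" by (simp add: r'_def r0)
    moreover have "\<forall>S\<subseteq>insert e E. r' S \<le> N \<and> card (kernel \<phi>' S) = p ^ (N - r' S)"
      using rank' by blast
    moreover have "\<forall>S\<subseteq>insert e E. \<forall>l. (\<forall>e\<in>S. lev e \<le> l) \<longrightarrow>
        r' S = min (w l) (r' {e \<in> S. lev e < l} + card {e \<in> S. lev e = l})"
      using rec' by blast
    ultimately show ?thesis by (intro exI[of _ \<phi>'] exI[of _ r'] conjI)
  qed
qed

end

section \<open>Lattices in which joins of incomparable elements form a chain\<close>

context prime_vectors
begin

lemma kernel_subset: "kernel \<phi> S \<subseteq> vecs"
  by (auto simp: kernel_def)

lemma finite_kernel: "finite (kernel \<phi> S)"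
  using kernel_subset finite_vecs by (rule finite_subset)

lemma kernel_iff_forms_eq:
  assumes "u \<in> vecs" "v \<in> vecs"
  shows "comb u (-1) v \<in> kernel \<phi> S \<longleftrightarrow> (\<forall>e\<in>S. form (\<phi> e) u = form (\<phi> e) v)"
proof -
  have "form a (comb u (-1) v) = 0 \<longleftrightarrow> form a u = form a v" for a
  proof -
    have "form a (comb u (-1) v) = 0 \<longleftrightarrow> form a u mod int p = form a v mod int p"
      by (simp add: form_comb mod_eq_dvd_iff mod_eq_0_iff_dvd)
    thus ?thesis using form_range[of a] by simp
  qed
  thus ?thesis by (simp add: kernel_def comb_vecs assms)
qed

text \<open>The fibre through \<open>u\<close> is a translate of the kernel, so all fibres have the
  same size, as \<open>quasi_uniform\<close> asks.\<close>

lemma card_forms_eq: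
  assumes u: "u \<in> vecs"
  shows "card {v \<in> vecs. \<forall>e\<in>S. form (\<phi> e) v = form (\<phi> e) u} = card (kernel \<phi> S)"
proof -
  have "bij_betw (\<lambda>v. comb v (-1) u) {v \<in> vecs. \<forall>e\<in>S. form (\<phi> e) v = form (\<phi> e) u} (kernel \<phi> S)"
  proof (rule bij_betw_byWitness[where f' = "\<lambda>k. comb k 1 u"])
    show "\<forall>v\<in>{v \<in> vecs. \<forall>e\<in>S. form (\<phi> e) v = form (\<phi> e) u}. comb (comb v (-1) u) 1 u = v"
      using comb_cancel[of _ "-1" u] by simp
    show "\<forall>k\<in>kernel \<phi> S. comb (comb k 1 u) (-1) u = k"
      using comb_cancel[of _ 1 u] by (simp add: kernel_def)
    show "(\<lambda>v. comb v (-1) u) ` {v \<in> vecs. \<forall>e\<in>S. form (\<phi> e) v = form (\<phi> e) u} \<subseteq> kernel \<phi> S"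
      using kernel_iff_forms_eq[OF _ u] by blast
    show "(\<lambda>k. comb k 1 u) ` kernel \<phi> S \<subseteq> {v \<in> vecs. \<forall>e\<in>S. form (\<phi> e) v = form (\<phi> e) u}"
      using form_range u by (auto simp: kernel_def form_comb comb_vecs)
  qed
  thus ?thesis by (rule bij_betw_same_card)
qed

end

text \<open>Bottom and top are put into \<open>T\<close> so that each element has a least member of
  \<open>T\<close> above it and induction along \<open>T\<close> has a start. \<open>d\<close> is an
  integral polymatroid function.\<close>

locale join_chain =
  fixes T :: "'a::{finite,lattice} set" and z tp :: 'a and d :: "'a \<Rightarrow> nat"
  assumes chain: "\<And>s t. s \<in> T \<Longrightarrow> t \<in> T \<Longrightarrow> s \<le> t \<or> t \<le> s"
    and zT: "z \<in> T" and z: "\<And>x. z \<le> x"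
    and tpT: "tp \<in> T" and tp: "\<And>x. x \<le> tp"
    and join: "\<And>x y. \<not> x \<le> y \<Longrightarrow> \<not> y \<le> x \<Longrightarrow> sup x y \<in> T"
    and d_mono: "\<And>x y. x \<le> y \<Longrightarrow> d x \<le> d y"
    and d_sub: "\<And>x y. d (sup x y) + d (inf x y) \<le> d x + d y"
begin

text \<open>Two incomparable elements below \<open>y\<close> have their join in \<open>T\<close>,
  hence strictly below \<open>y\<close>. So a maximal element below \<open>y\<close> is the largest
  one.\<close>

lemma ex_lower_cover:
  assumes "y \<notin> T"
  shows "\<exists>x<y. \<forall>u<y. u \<le> x"
proof -
  have "z \<in> {x. x < y}" using z[of y] zT assms by (auto simp: order_less_le)
  then obtain x where x: "x < y" "\<And>u. u < y \<Longrightarrow> x \<le> u \<Longrightarrow> u = x"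
    using finite_has_maximal[of "{x. x < y}"] by auto
  have "u \<le> x" if u: "u < y" for u
  proof (rule ccontr)
    assume n: "\<not> u \<le> x"
    have n': "\<not> x \<le> u" using x(2)[OF u] n by auto
    have "sup x u \<in> T" by (rule join[OF n' n])
    hence "sup x u < y" using x(1) u assms by (auto simp: order_less_le)
    from x(2)[OF this sup_ge1] have "u \<le> x" by (metis sup_ge2)
    with n show False ..
  qed
  with x(1) show ?thesis by blast
qed

definition lower :: "'a \<Rightarrow> 'a" where
  "lower y = (SOME x. x < y \<and> (\<forall>u<y. u \<le> x))"

lemma lower:
  assumes "y \<notin> T"
  shows "lower y < y" "u < y \<Longrightarrow> u \<le> lower y"
  using someI_ex[OF ex_lower_cover[OF assms]] by (auto simp: lower_def)

text \<open>The position in the chain \<open>T\<close> of the least member above \<open>y\<close>,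
  counted from 0 at the bottom.\<close>

definition level :: "'a \<Rightarrow> nat" where
  "level y = card {t \<in> T. \<not> y \<le> t}"

text \<open>At \<open>l = level t\<close> this is \<open>d t\<close>, the dimension of the space
  attached to \<open>t\<close>; the maximum extends it monotonically to all
  \<open>l\<close>.\<close>

definition width :: "nat \<Rightarrow> nat" where
  "width l = Max (d ` {t \<in> T. level t \<le> l})"

text \<open>The number of generic forms introduced at \<open>y\<close>. Outside \<open>T\<close> it
  is the increase of \<open>d\<close> over the lower cover; a member \<open>t\<close> of
  \<open>T\<close> gets \<open>d t\<close> of them, enough to fill its space whatever lies
  below.\<close>

definition units :: "'a \<Rightarrow> nat" where
  "units y = (if y \<in> T then d y else d y - d (lower y))"

lemma level_le_iff: "t \<in> T \<Longrightarrow> level y \<le> level t \<longleftrightarrow> y \<le> t"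
proof
  assume t: "t \<in> T" and "y \<le> t"
  thus "level y \<le> level t"
    unfolding level_def by (intro card_mono) (auto intro: order_trans)
next
  assume t: "t \<in> T" and l: "level y \<le> level t"
  show "y \<le> t"
  proof (rule ccontr)
    assume n: "\<not> y \<le> t"
    have "{s \<in> T. \<not> t \<le> s} \<subset> {s \<in> T. \<not> y \<le> s}"
      using n t chain by (blast intro: order_trans)
    hence "level t < level y" unfolding level_def by (intro psubset_card_mono) auto
    with l show False by simp
  qed
qed

lemma width_level: "t \<in> T \<Longrightarrow> width (level t) = d t"
  unfolding width_def by (rule Max_eqI) (auto simp: level_le_iff d_mono)

lemma level_z: "level z = 0"
  using z by (simp add: level_def)

lemma mono_width: "mono width"
proof (rule monoI)
  fix k l :: nat assume "k \<le> l"
  moreover have "z \<in> {t \<in> T. level t \<le> k}" using zT level_z by simp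
  ultimately show "width k \<le> width l"
    unfolding width_def by (intro Max_mono) auto
qed

lemma width_le: "width l \<le> d tp"
proof -
  have "z \<in> {t \<in> T. level t \<le> l}" using zT level_z by simp
  hence "d ` {t \<in> T. level t \<le> l} \<noteq> {}" by blast
  thus ?thesis unfolding width_def using tp d_mono by simp
qed

lemma ex_pred:
  assumes "t \<in> T" "t \<noteq> z"
  obtains t' where "t' \<in> T" "t' < t" "\<And>s. s \<in> T \<Longrightarrow> s < t \<Longrightarrow> s \<le> t'"
proof -
  have "z \<in> {s \<in> T. s < t}" using assms zT z by (auto simp: order_less_le)
  then obtain t' where t': "t' \<in> T" "t' < t" "\<And>s. s \<in> T \<Longrightarrow> s < t \<Longrightarrow> t' \<le> s \<Longrightarrow> s = t'"
    using finite_has_maximal[of "{s \<in> T. s < t}"] by auto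
  show thesis
  proof (rule that[OF t'(1,2)])
    show "s \<le> t'" if "s \<in> T" "s < t" for s
      using chain[OF that(1) t'(1)] t'(3)[OF that] by auto
  qed
qed

lemma level_less_iff:
  assumes "t \<in> T" "t' \<in> T" "t' < t" "\<And>s. s \<in> T \<Longrightarrow> s < t \<Longrightarrow> s \<le> t'"
  shows "level y < level t \<longleftrightarrow> y \<le> t'"
proof
  assume "y \<le> t'"
  hence "level y \<le> level t'" using assms by (simp add: level_le_iff)
  also have "\<not> level t \<le> level t'" using assms by (simp add: level_le_iff less_le_not_le)
  hence "level t' < level t" by simp
  finally show "level y < level t" .
next
  assume l: "level y < level t"
  show "y \<le> t'"
  proof (rule ccontr)
    assume n: "\<not> y \<le> t'"
    have "{s \<in> T. \<not> t \<le> s} \<subseteq> {s \<in> T. \<not> y \<le> s}"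
    proof clarify
      fix s assume s: "s \<in> T" "\<not> t \<le> s" "y \<le> s"
      hence "s < t" using chain[OF s(1) assms(1)] by (auto simp: order_less_le)
      hence "s \<le> t'" using assms(4) s(1) by blast
      thus False using n s(3) by (meson order_trans)
    qed
    hence "level t \<le> level y" unfolding level_def by (intro card_mono) auto
    with l show False by simp
  qed
qed

text \<open>Between consecutive members \<open>t'\<close> and \<open>t\<close>, the elements below
  \<open>x\<close> but not below \<open>t'\<close> are \<open>x\<close>, \<open>lower x\<close> and
  so on. None is in \<open>T\<close>, so their units are increments of \<open>d\<close>, which
  telescope down to \<open>inf x t'\<close>.\<close>

lemma sum_units_telescope:
  assumes t: "t \<in> T" "t' \<in> T" "t' < t" "\<And>s. s \<in> T \<Longrightarrow> s < t \<Longrightarrow> s \<le> t'"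
  shows "x < t \<Longrightarrow> sum units {u. u \<le> x \<and> \<not> u \<le> t'} + d (inf x t') = d x"
proof (induction "card {u. u < x}" arbitrary: x rule: less_induct)
  case less
  show ?case
  proof (cases "x \<le> t'")
    case True
    hence eq: "{u. u \<le> x \<and> \<not> u \<le> t'} = {}" by (auto intro: order_trans)
    show ?thesis unfolding eq using True by (simp add: inf_absorb1)
  next
    case False
    hence xT: "x \<notin> T" using t(4) less.prems by blast
    let ?y = "lower x"
    note y = lower[OF xT]
    have eq: "{u. u \<le> x \<and> \<not> u \<le> t'} = insert x {u. u \<le> ?y \<and> \<not> u \<le> t'}"
      using y False by (auto simp: order_le_less intro: order_less_trans)
    have "inf x t' < x" using False by (metis inf_le1 inf_le2 less_le)
    hence inf: "inf x t' = inf ?y t'"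
    proof (intro order_antisym)
      show "inf x t' \<le> inf ?y t'" using y(2)[OF \<open>inf x t' < x\<close>] by simp
      show "inf ?y t' \<le> inf x t'" using y(1) by (intro inf_mono) auto
    qed
    have "{u. u < ?y} \<subset> {u. u < x}"
      using y(1) by (auto intro: order_less_trans)
    hence "card {u. u < ?y} < card {u. u < x}" by (intro psubset_card_mono) auto
    moreover have "?y < t" using y(1) less.prems by (rule order_less_trans)
    ultimately have IH: "sum units {u. u \<le> ?y \<and> \<not> u \<le> t'} + d (inf ?y t') = d ?y"
      by (rule less.hyps)
    have "x \<notin> {u. u \<le> ?y \<and> \<not> u \<le> t'}" using y(1) by (auto simp: less_le_not_le)
    hence "sum units {u. u \<le> x \<and> \<not> u \<le> t'} = units x + sum units {u. u \<le> ?y \<and> \<not> u \<le> t'}"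
      unfolding eq by simp
    moreover have "units x = d x - d ?y" "d ?y \<le> d x"
      using xT y(1) by (auto simp: units_def intro: d_mono order_less_imp_le)
    ultimately show ?thesis using IH inf by simp
  qed
qed

definition unit_set :: "'a set \<Rightarrow> ('a \<times> nat) set" where
  "unit_set D = Sigma D (\<lambda>y. {..<units y})"

lemma finite_unit_set: "finite (unit_set D)"
  by (simp add: unit_set_def)

text \<open>The join \<open>?v\<close> of the two traces below \<open>t'\<close> is incomparable to
  \<open>x\<close>, so \<open>sup x ?v\<close> is in \<open>T\<close>; it is below \<open>t\<close>
  but not below \<open>t'\<close>, hence equal to \<open>t\<close>. Submodularity at
  \<open>x\<close> and \<open>?v\<close> gives the bound.\<close>

lemma step_bound:
  assumes t: "t \<in> T" "t' \<in> T" "t' < t" "\<And>s. s \<in> T \<Longrightarrow> s < t \<Longrightarrow> s \<le> t'"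
    and xy: "x < t" "\<not> x \<le> t'"
    and n: "\<not> inf x t' \<le> inf y t'" "\<not> inf y t' \<le> inf x t'"
  shows "d t + d (inf x t') \<le> d x + d (sup (inf x t') (inf y t'))"
proof -
  let ?v = "sup (inf x t') (inf y t')"
  have "?v \<le> t'" by simp
  have "\<not> ?v \<le> x"
  proof
    assume "?v \<le> x"
    hence "inf y t' \<le> inf x t'" by simp
    with n show False by blast
  qed
  moreover have "\<not> x \<le> ?v" using xy(2) \<open>?v \<le> t'\<close> order_trans by blast
  ultimately have "sup x ?v \<in> T" by (rule join[rotated])
  moreover have "sup x ?v \<le> t"
    using xy(1) t(3) by (simp add: order_less_imp_le le_infI2)
  moreover have "\<not> sup x ?v \<le> t'" using xy(2) by (meson le_sup_iff)
  ultimately have "sup x ?v = t" using t(4)[of "sup x ?v"] by (metis order_le_imp_less_or_eq)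
  moreover have "d (inf x t') \<le> d (inf x ?v)" by (rule d_mono) simp
  ultimately show ?thesis using d_sub[of x ?v] by simp
qed

text \<open>Induction along \<open>T\<close>. With \<open>t'\<close> the predecessor of
  \<open>t\<close>, the forms of level less than \<open>level t\<close> sit below
  \<open>inf x t'\<close> or \<open>inf y t'\<close> and have rank \<open>q\<close> by induction;
  the \<open>\<sigma>\<close> forms of level \<open>level t\<close> add to it up to the bound
  \<open>d t\<close>. It remains to compare \<open>min (d t) (q + \<sigma>)\<close> with
  \<open>d (sup x y)\<close>.\<close>

lemma rank_join:
  assumes r0: "r {} = 0"
    and rec: "\<And>S l. (\<And>e. e \<in> S \<Longrightarrow> level (fst e) \<le> l) \<Longrightarrow> S \<subseteq> unit_set UNIV \<Longrightarrow>
       r S = min (width l) (r {e \<in> S. level (fst e) < l} + card {e \<in> S. level (fst e) = l})"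
  shows "t \<in> T \<Longrightarrow> x \<le> t \<Longrightarrow> y \<le> t \<Longrightarrow> r (unit_set ({..x} \<union> {..y})) = d (sup x y)"
proof (induction "level t" arbitrary: t x y rule: less_induct)
  case less
  note t = less.prems(1)
  let ?D = "{..x} \<union> {..y}"
  have Dt: "u \<le> t" if "u \<in> ?D" for u using that less.prems by (auto intro: order_trans)
  have rD: "r (unit_set ?D) = min (d t)
      (r (unit_set {u \<in> ?D. level u < level t}) + sum units {u \<in> ?D. level u = level t})"
  proof -
    have "r (unit_set ?D) = min (width (level t))
        (r {e \<in> unit_set ?D. level (fst e) < level t} + card {e \<in> unit_set ?D. level (fst e) = level t})"
      using Dt t by (intro rec) (auto simp: unit_set_def level_le_iff)
    moreover have "{e \<in> unit_set ?D. level (fst e) < level t} = unit_set {u \<in> ?D. level u < level t}"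
      "{e \<in> unit_set ?D. level (fst e) = level t} = unit_set {u \<in> ?D. level u = level t}"
      by (auto simp: unit_set_def)
    moreover have "card (unit_set {u \<in> ?D. level u = level t}) = sum units {u \<in> ?D. level u = level t}"
      by (simp add: unit_set_def)
    ultimately show ?thesis using t by (simp add: width_level)
  qed
  show ?case
  proof (cases "t = z")
    case True
    hence "x = z" "y = z" using less.prems z by (auto intro: order_antisym)
    moreover have "{..z} = {z}" using z by (auto intro: order_antisym)
    ultimately show ?thesis using rD zT by (simp add: True unit_set_def r0 units_def Collect_conv_if)
  next
    case False
    obtain t' where t': "t' \<in> T" "t' < t" "\<And>s. s \<in> T \<Longrightarrow> s < t \<Longrightarrow> s \<le> t'"
      using ex_pred[OF t False] by blast
    note tt = t t'
    have ll: "level u < level t \<longleftrightarrow> u \<le> t'" for u by (rule level_less_iff[OF tt])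
    have IH: "r (unit_set ({..u} \<union> {..v})) = d (sup u v)" if "u \<le> t'" "v \<le> t'" for u v
      using less.hyps[of t'] ll t'(1) that by blast
    have low: "{u \<in> ?D. level u < level t} = {..inf x t'} \<union> {..inf y t'}"
      by (auto simp: ll)
    have high: "{u \<in> ?D. level u = level t} = {u. u \<le> x \<and> \<not> u \<le> t'} \<union> {u. u \<le> y \<and> \<not> u \<le> t'}"
    proof -
      have "level u = level t \<longleftrightarrow> \<not> u \<le> t'" if "u \<in> ?D" for u
        using ll[of u] Dt[OF that] level_le_iff[OF t, of u] by linarith
      thus ?thesis by auto
    qed
    define q where "q = d (sup (inf x t') (inf y t'))"
    define \<sigma> where "\<sigma> = sum units ({u. u \<le> x \<and> \<not> u \<le> t'} \<union> {u. u \<le> y \<and> \<not> u \<le> t'})"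
    have R: "r (unit_set ?D) = min (d t) (q + \<sigma>)"
      unfolding rD low high using IH[of "inf x t'" "inf y t'"] by (simp add: q_def \<sigma>_def)
    have tele: "sum units {u. u \<le> v \<and> \<not> u \<le> t'} + d (inf v t') = d v" if "v < t" for v
      by (rule sum_units_telescope[OF tt that])
    have nt: "\<not> t \<le> t'" using t'(2) by (simp add: less_le_not_le)
    consider "x = t \<or> y = t" | "x < t" "y < t" "x \<le> y" | "x < t" "y < t" "y \<le> x"
      | "x < t" "y < t" "\<not> x \<le> y" "\<not> y \<le> x"
      using less.prems(2,3) by (auto simp: order_le_less)
    thus ?thesis
    proof cases
      \<comment> \<open>Here \<open>units t = d t\<close> alone reaches the bound
        \<open>d t\<close>.\<close>
      case 1
      hence "sup x y = t" using less.prems by (auto simp: sup_absorb1 sup_absorb2)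
      moreover have "units t \<le> \<sigma>"
        unfolding \<sigma>_def using 1 nt by (intro member_le_sum) auto
      ultimately show ?thesis using R t by (simp add: units_def)
    next
      case 2
      hence "{u. u \<le> x \<and> \<not> u \<le> t'} \<union> {u. u \<le> y \<and> \<not> u \<le> t'} = {u. u \<le> y \<and> \<not> u \<le> t'}"
        by (auto intro: order_trans)
      hence "\<sigma> + d (inf y t') = d y" using tele[OF 2(2)] by (simp add: \<sigma>_def)
      moreover have "sup (inf x t') (inf y t') = inf y t'"
        by (rule sup_absorb2[OF inf_mono[OF 2(3) order_refl]])
      ultimately show ?thesis
        using R 2(3) d_mono[of y t] less.prems by (simp add: q_def sup_absorb2 add.commute)
    next
      case 3
      hence "{u. u \<le> x \<and> \<not> u \<le> t'} \<union> {u. u \<le> y \<and> \<not> u \<le> t'} = {u. u \<le> x \<and> \<not> u \<le> t'}"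
        by (auto intro: order_trans)
      hence "\<sigma> + d (inf x t') = d x" using tele[OF 3(1)] by (simp add: \<sigma>_def)
      moreover have "sup (inf x t') (inf y t') = inf x t'"
        by (rule sup_absorb1[OF inf_mono[OF 3(3) order_refl]])
      ultimately show ?thesis
        using R 3(3) d_mono[of x t] less.prems by (simp add: q_def sup_absorb1 add.commute)
    next
      case 4
      \<comment> \<open>The join is a member of \<open>T\<close> below \<open>t\<close>, so it is
        \<open>t\<close> or lies below \<open>t'\<close>; in the second case the induction
        hypothesis applies.\<close>
      have sT: "sup x y \<in> T" by (rule join[OF 4(3,4)])
      show ?thesis
      proof (cases "sup x y = t")
        case False
        hence "sup x y < t" using less.prems by (simp add: order_less_le)
        hence "sup x y \<le> t'" using sT t'(3) by blast
        thus ?thesis using IH by simp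
      next
        case True
        define m where "m = inf x y"
        have mt: "m < t" unfolding m_def using 4(1) by (simp add: order_le_less_trans[OF inf_le1])
        have "{u. u \<le> x \<and> \<not> u \<le> t'} \<inter> {u. u \<le> y \<and> \<not> u \<le> t'} = {u. u \<le> m \<and> \<not> u \<le> t'}"
          by (auto simp: m_def)
        hence \<sigma>: "\<sigma> + sum units {u. u \<le> m \<and> \<not> u \<le> t'} =
            sum units {u. u \<le> x \<and> \<not> u \<le> t'} + sum units {u. u \<le> y \<and> \<not> u \<le> t'}"
          unfolding \<sigma>_def
          using sum.union_inter[of "{u. u \<le> x \<and> \<not> u \<le> t'}" "{u. u \<le> y \<and> \<not> u \<le> t'}" units] by simp
        have sub: "d t + d m \<le> d x + d y" using d_sub[of x y] by (simp add: True m_def)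
        \<comment> \<open>If the traces below \<open>t'\<close> are comparable, the smaller one is
          the trace of \<open>m\<close> and the larger one has value \<open>q\<close>, so
          telescoping gives \<open>q + \<sigma> = d x + d y - d m\<close>. Incomparable traces are
          left to \<open>step_bound\<close>.\<close>
        have "d t \<le> q + \<sigma>"
        proof -
          consider "inf x t' \<le> inf y t'" | "inf y t' \<le> inf x t'"
            | "\<not> inf x t' \<le> inf y t'" "\<not> inf y t' \<le> inf x t'" by blast
          thus ?thesis
          proof cases
            case 1
            hence "sup (inf x t') (inf y t') = inf y t'" by (rule sup_absorb2)
            moreover have "inf m t' = inf x t'"
            proof (rule order_antisym)
              show "inf m t' \<le> inf x t'" unfolding m_def by (intro inf_mono inf_le1 order_refl)
              show "inf x t' \<le> inf m t'" using 1 by (simp add: m_def)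
            qed
            ultimately show ?thesis
              using \<sigma> tele[OF 4(1)] tele[OF 4(2)] tele[OF mt] sub by (simp add: q_def)
          next
            case 2
            hence "sup (inf x t') (inf y t') = inf x t'" by (rule sup_absorb1)
            moreover have "inf m t' = inf y t'"
            proof (rule order_antisym)
              show "inf m t' \<le> inf y t'" unfolding m_def by (intro inf_mono inf_le2 order_refl)
              show "inf y t' \<le> inf m t'" using 2 by (simp add: m_def)
            qed
            ultimately show ?thesis
              using \<sigma> tele[OF 4(1)] tele[OF 4(2)] tele[OF mt] sub by (simp add: q_def)
          next
            case 3
            \<comment> \<open>Otherwise either \<open>inf x t' \<le> m\<close>, making the traces
              comparable, or \<open>sup m (inf x t')\<close> is a member of \<open>T\<close> below
              \<open>x\<close>, hence below \<open>t'\<close>, yet above \<open>m\<close>. So the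
              two sums in \<open>\<sigma>\<close> do not overlap.\<close>
            have "m \<le> t'"
            proof (rule ccontr)
              assume n: "\<not> m \<le> t'"
              have "inf x t' \<le> m"
              proof (rule ccontr)
                assume n': "\<not> inf x t' \<le> m"
                have "\<not> m \<le> inf x t'" using n by auto
                hence "sup m (inf x t') \<in> T" using n' by (intro join)
                moreover have "sup m (inf x t') \<le> x" by (simp add: m_def)
                ultimately have "sup m (inf x t') \<le> t'" using t'(3) 4(1) by (meson order_le_less_trans)
                with n show False by simp
              qed
              hence "inf x t' \<le> inf y t'" by (simp add: m_def)
              with 3 show False by blast
            qed
            hence m0: "{u. u \<le> m \<and> \<not> u \<le> t'} = {}" by (auto intro: order_trans)
            have \<sigma>': "\<sigma> = sum units {u. u \<le> x \<and> \<not> u \<le> t'} + sum units {u. u \<le> y \<and> \<not> u \<le> t'}"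
              using \<sigma> unfolding m0 by simp
            have "\<not> x \<le> t' \<or> \<not> y \<le> t'" using nt True by (metis sup_least)
            thus ?thesis
            proof
              assume "\<not> x \<le> t'"
              from step_bound[OF tt 4(1) this 3] show ?thesis
                using \<sigma>' tele[OF 4(1)] unfolding q_def by linarith
            next
              assume "\<not> y \<le> t'"
              from step_bound[OF tt 4(2) this 3(2,1)] show ?thesis
                using \<sigma>' tele[OF 4(2)] unfolding q_def sup_commute[of "inf y t'"] by linarith
            qed
          qed
        qed
        thus ?thesis using R True by simp
      qed
    qed
  qed
qed

text \<open>A uniform vector of length \<open>d tp\<close> is observed through the generic forms at
  all elements below \<open>x\<close>. The entropy is \<open>log 2 p\<close> times the rank, and the
  factor is scaled away.\<close>

lemma approximable_d: "approximable (\<lambda>x. real (d x))"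
proof -
  obtain p :: nat where large: "prime p" "2 ^ card (unit_set UNIV) < p"
    using bigger_prime by blast
  interpret prime_vectors p "d tp" by unfold_locales (rule large)
  obtain \<phi> r where rank: "\<forall>S\<subseteq>unit_set UNIV. r S \<le> d tp \<and> card (kernel \<phi> S) = p ^ (d tp - r S)"
    and r0: "r {} = 0"
    and rec: "\<forall>S\<subseteq>unit_set UNIV. \<forall>l. (\<forall>e\<in>S. level (fst e) \<le> l) \<longrightarrow>
       r S = min (width l) (r {e \<in> S. level (fst e) < l} + card {e \<in> S. level (fst e) = l})"
    using generic_forms[OF finite_unit_set mono_width width_le large(2), of "\<lambda>e. level (fst e)"]
    by (elim exE conjE)
  have rj: "r (unit_set ({..x} \<union> {..y})) = d (sup x y)" for x y
  proof (rule rank_join[of r tp])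
    show "r S = min (width l) (r {e \<in> S. level (fst e) < l} + card {e \<in> S. level (fst e) = l})"
      if "\<And>e. e \<in> S \<Longrightarrow> level (fst e) \<le> l" "S \<subseteq> unit_set UNIV" for S l
      using rec[rule_format, OF that(2), of l] that(1) by blast
  qed (use r0 tpT tp in auto)
  have cj: "card (kernel \<phi> (unit_set ({..x} \<union> {..y}))) = p ^ (d tp - d (sup x y))" for x y
  proof -
    have "unit_set ({..x} \<union> {..y}) \<subseteq> unit_set UNIV" by (auto simp: unit_set_def)
    with rank have "card (kernel \<phi> (unit_set ({..x} \<union> {..y}))) =
        p ^ (d tp - r (unit_set ({..x} \<union> {..y})))" by blast
    thus ?thesis by (simp only: rj)
  qed
  have c1: "card (kernel \<phi> (unit_set {..x})) = p ^ (d tp - d x)" for x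
    using cj[of x x] by simp
  have kj: "kernel \<phi> (unit_set {..sup x y}) = kernel \<phi> (unit_set {..x}) \<inter> kernel \<phi> (unit_set {..y})" for x y
  proof -
    \<comment> \<open>The join sees every form that \<open>x\<close> and \<open>y\<close> see, and
      by \<open>rank_join\<close> with no gain in rank: the kernels are nested and of equal
      size.\<close>
    have "kernel \<phi> (unit_set {..sup x y}) \<subseteq> kernel \<phi> (unit_set ({..x} \<union> {..y}))"
      by (auto simp: kernel_def unit_set_def intro: le_supI1 le_supI2)
    hence "kernel \<phi> (unit_set {..sup x y}) = kernel \<phi> (unit_set ({..x} \<union> {..y}))"
      using c1[of "sup x y"] cj[of x y] by (intro card_seteq finite_kernel) auto
    also have "\<dots> = kernel \<phi> (unit_set {..x}) \<inter> kernel \<phi> (unit_set {..y})"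
      by (auto simp: kernel_def unit_set_def)
    finally show ?thesis .
  qed
  define F where "F x u = restrict (\<lambda>e. form (\<phi> e) u) (unit_set {..x})" for x u
  have F: "F x u = F x v \<longleftrightarrow> (\<forall>e\<in>unit_set {..x}. form (\<phi> e) u = form (\<phi> e) v)" for x u v
  proof (intro iffI ballI)
    fix e assume eq: "F x u = F x v" and e: "e \<in> unit_set {..x}"
    have "F x u e = F x v e" by (simp only: eq)
    with e show "form (\<phi> e) u = form (\<phi> e) v" by (simp add: F_def)
  next
    assume "\<forall>e\<in>unit_set {..x}. form (\<phi> e) u = form (\<phi> e) v"
    thus "F x u = F x v" unfolding F_def by (intro restrict_ext) blast
  qed
  have "quasi_uniform (\<lambda>x. log 2 p * real (d x))"
  proof (rule quasi_uniformI[of vecs F "\<lambda>x. p ^ (d tp - d x)"])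
    show "finite vecs" by (rule finite_vecs)
    show "vecs \<noteq> {}" using card_vecs p_gt_1 by auto
    show "join_compatible vecs F"
      unfolding join_compatible_def
    proof (intro allI ballI)
      fix x y u v assume uv: "u \<in> vecs" "v \<in> vecs"
      show "F (sup x y) u = F (sup x y) v \<longleftrightarrow> F x u = F x v \<and> F y u = F y v"
        unfolding F kernel_iff_forms_eq[OF uv, symmetric] kj by (rule Int_iff)
    qed
    show "card (fibre vecs (F x) u) = p ^ (d tp - d x)" if "u \<in> vecs" for x u
      unfolding fibre_def F card_forms_eq[OF that] c1 ..
    show "log 2 p * real (d x) = log 2 (card vecs / real (p ^ (d tp - d x)))" for x
    proof -
      have le: "d x \<le> d tp" using tp d_mono by blast
      have "real (card vecs) / real (p ^ (d tp - d x)) = real p ^ d x"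
        using le p_gt_1 by (simp add: card_vecs field_simps flip: power_add)
      thus ?thesis using p_gt_1 by (simp add: log_nat_power)
    qed
  qed
  hence "approximable (\<lambda>x. 1 / log 2 p * (log 2 p * real (d x)))"
    using p_gt_1 by (intro approximable_scale quasi_uniform_approximable) auto
  moreover have "log 2 p > 0" using p_gt_1 by (subst zero_less_log_cancel_iff) auto
  ultimately show ?thesis by simp
qed

end

section \<open>Rounding to an integral polymatroid function\<close>

lemma chain_approximable:
  fixes T :: "'a::{finite,lattice} set" and h :: "'a \<Rightarrow> real"
  assumes chain: "\<And>s t. s \<in> T \<Longrightarrow> t \<in> T \<Longrightarrow> s \<le> t \<or> t \<le> s"
    and join: "\<And>x y. \<not> x \<le> y \<Longrightarrow> \<not> y \<le> x \<Longrightarrow> sup x y \<in> T"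
    and h: "polymatroid h"
  shows "approximable h"
proof (rule approximable_closed)
  fix e :: real assume e: "e > 0"
  define g where "g x = card {m. \<not> x \<le> m}" for x :: 'a
  define c where "c = real (2 * CARD('a) + 1)"
  have "c > 0" by (simp add: c_def)
  obtain n :: nat where n: "c / e < n" using reals_Archimedean2 by blast
  have "c / e > 0" using \<open>c > 0\<close> e by simp
  hence n0: "n > 0" using n by (simp add: order_less_trans[of 0 "c / e" "real n", simplified])
  \<comment> \<open>Rounding down violates submodularity at an incomparable pair by at most 2. The
    summand \<open>2 * g x\<close> makes up for it, since there \<open>g\<close> is submodular with
    a margin of 1.\<close>
  define d where "d x = nat \<lfloor>n * h x\<rfloor> + 2 * g x" for x
  have hnn: "h x \<ge> 0" for x using h by (simp add: polymatroid_def)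
  have hm: "h x \<le> h y" if "x \<le> y" for x y using h that by (simp add: polymatroid_def)
  have hs: "h (sup x y) + h (inf x y) \<le> h x + h y" for x y using h by (simp add: polymatroid_def)
  have gm: "g x \<le> g y" if "x \<le> y" for x y
    unfolding g_def using that by (intro card_mono) (auto intro: order_trans)
  have gs: "g (sup x y) + g (inf x y) + 1 \<le> g x + g y" if "\<not> x \<le> y" "\<not> y \<le> x" for x y
  proof -
    \<comment> \<open>The margin comes from \<open>inf x y\<close>, which is in both sets on the
      right but not in the one on the left.\<close>
    have "{m. \<not> inf x y \<le> m} \<subset> {m. \<not> x \<le> m} \<inter> {m. \<not> y \<le> m}"
    proof
      show "{m. \<not> inf x y \<le> m} \<subseteq> {m. \<not> x \<le> m} \<inter> {m. \<not> y \<le> m}"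
        by (auto intro: le_infI1 le_infI2)
      have "inf x y \<in> {m. \<not> x \<le> m} \<inter> {m. \<not> y \<le> m}" using that by simp
      thus "{m. \<not> inf x y \<le> m} \<noteq> {m. \<not> x \<le> m} \<inter> {m. \<not> y \<le> m}" by blast
    qed
    hence "g (inf x y) < card ({m. \<not> x \<le> m} \<inter> {m. \<not> y \<le> m})"
      unfolding g_def by (intro psubset_card_mono) auto
    moreover have "{m. \<not> sup x y \<le> m} = {m. \<not> x \<le> m} \<union> {m. \<not> y \<le> m}" by auto
    hence "g (sup x y) + card ({m. \<not> x \<le> m} \<inter> {m. \<not> y \<le> m}) = g x + g y"
      unfolding g_def using card_Un_Int[of "{m. \<not> x \<le> m}" "{m. \<not> y \<le> m}"] by simp
    ultimately show ?thesis by simp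
  qed
  define z tp where "z = Inf_fin (UNIV :: 'a set)" and "tp = Sup_fin (UNIV :: 'a set)"
  have z: "z \<le> x" and tp: "x \<le> tp" for x
    by (simp_all add: z_def tp_def Inf_fin.coboundedI Sup_fin.coboundedI)
  interpret join_chain "insert z (insert tp T)" z tp d
  proof
    show "s \<le> t \<or> t \<le> s" if "s \<in> insert z (insert tp T)" "t \<in> insert z (insert tp T)" for s t
      using that chain z tp by auto
    show "d x \<le> d y" if "x \<le> y" for x y
    proof -
      have "n * h x \<le> n * h y" using hm[OF that] by (simp add: mult_left_mono)
      thus ?thesis using gm[OF that] by (simp add: d_def add_mono nat_mono floor_mono)
    qed
    show "d (sup x y) + d (inf x y) \<le> d x + d y" for x y
    proof -
      consider "x \<le> y" | "y \<le> x" | "\<not> x \<le> y" "\<not> y \<le> x" by blast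
      thus ?thesis
      proof cases
        case 3
        have "n * h (sup x y) + n * h (inf x y) \<le> n * h x + n * h y"
          using hs[of x y] by (simp flip: distrib_left add: mult_left_mono)
        hence "\<lfloor>n * h (sup x y)\<rfloor> + \<lfloor>n * h (inf x y)\<rfloor> \<le> \<lfloor>n * h x\<rfloor> + \<lfloor>n * h y\<rfloor> + 2" by linarith
        moreover have "int (nat \<lfloor>n * h v\<rfloor>) = \<lfloor>n * h v\<rfloor>" for v using hnn[of v] by simp
        ultimately have "nat \<lfloor>n * h (sup x y)\<rfloor> + nat \<lfloor>n * h (inf x y)\<rfloor> \<le>
            nat \<lfloor>n * h x\<rfloor> + nat \<lfloor>n * h y\<rfloor> + 2" 
          by (subst of_nat_le_iff[where 'a = int, symmetric]) (simp only: of_nat_add of_nat_numeral)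
        thus ?thesis using gs[OF 3] by (simp add: d_def)
      qed (simp_all add: sup_absorb1 sup_absorb2 inf_absorb1 inf_absorb2)
    qed
  qed (use z tp join in auto)
  have "approximable (\<lambda>x. 1 / n * real (d x))"
    using approximable_scale[OF approximable_d, of "1 / n"] by simp
  moreover have "\<bar>1 / n * real (d x) - h x\<bar> < e" for x
  proof -
    have "\<lfloor>n * h x\<rfloor> \<ge> 0" using hnn[of x] by simp
    hence "\<bar>real (nat \<lfloor>n * h x\<rfloor>) - n * h x\<bar> \<le> 1" by (simp, linarith)
    moreover have "g x \<le> CARD('a)" unfolding g_def by (rule card_mono) auto
    hence "real (g x) \<le> real CARD('a)" by simp
    ultimately have "\<bar>real (d x) - n * h x\<bar> \<le> c" unfolding d_def c_def by simp
    also have "c < n * e" using n e by (simp add: field_simps)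
    finally have "\<bar>real (d x) - n * h x\<bar> < n * e" .
    moreover have "1 / n * real (d x) - h x = (real (d x) - n * h x) / n"
      using n0 by (simp add: field_simps)
    ultimately show ?thesis using n0 by (simp add: abs_divide divide_less_eq mult.commute)
  qed
  ultimately show "\<exists>g. approximable g \<and> (\<forall>x. \<bar>g x - h x\<bar> < e)" by blast
qed

section \<open>Lattices with at most seven elements\<close>

theorem theorem10:
  assumes "CARD('a::{finite,lattice}) \<le> 7"
  shows "shannon_lattice TYPE('a)"
proof -
  define z where "z = Inf_fin (UNIV :: 'a set)"
  have z: "z \<le> x" for x by (simp add: z_def Inf_fin.coboundedI)
  define T where "T = {sup x y |x y :: 'a. \<not> x \<le> y \<and> \<not> y \<le> x}"
  \<comment> \<open>The join-irreducible elements: neither the bottom nor a join of two incomparable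
    elements.\<close>
  define I where "I = UNIV - insert z T"
  have zT: "z \<notin> T"
  proof
    assume "z \<in> T"
    then obtain x y where "z = sup x y" "\<not> x \<le> y" by (auto simp: T_def)
    hence "x \<le> z" by simp
    thus False using z[of x] z[of y] \<open>\<not> x \<le> y\<close> by (metis order_antisym)
  qed
  \<comment> \<open>Bottom, \<open>T\<close> and \<open>I\<close> partition the lattice, so
    \<open>card I \<ge> 4\<close> forces \<open>card T \<le> 2\<close>.\<close>
  have cards: "card I + card T \<le> 6"
  proof -
    have "card I = CARD('a) - card (insert z T)" unfolding I_def by (rule card_Diff_subset) auto
    moreover have "card (insert z T) = card T + 1" using zT by simp
    moreover have "card (insert z T) \<le> CARD('a)" by (rule card_mono) auto
    ultimately show ?thesis using assms by linarith
  qed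
  have "approximable h" if h: "polymatroid h" for h :: "'a \<Rightarrow> real"
  proof (cases "card I \<le> 3")
    case True
    \<comment> \<open>An element of \<open>T\<close> is the join of two strictly smaller ones, so by
      induction every element is the join of the members of \<open>I\<close> below it.\<close>
    have below: "x \<le> y" if "\<And>j. j \<in> I \<Longrightarrow> j \<le> x \<Longrightarrow> j \<le> y" for x y
      using that
    proof (induction "card {u. u < x}" arbitrary: x rule: less_induct)
      case less
      show ?case
      proof (cases "x \<in> T")
        case False
        thus ?thesis using less.prems[of x] z by (cases "x = z") (auto simp: I_def)
      next
        case True
        then obtain u v where uv: "x = sup u v" "\<not> u \<le> v" "\<not> v \<le> u" by (auto simp: T_def)
        have lt: "u < x" "v < x" using uv by (metis less_le sup_ge1 sup_ge2)+
        have "w \<le> y" if w: "w < x" for w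
        proof (rule less.hyps)
          have "{u. u < w} \<subset> {u. u < x}" using w by (auto intro: order_less_trans)
          thus "card {u. u < w} < card {u. u < x}" by (intro psubset_card_mono) auto
          show "j \<le> y" if "j \<in> I" "j \<le> w" for j
            using less.prems[OF that(1)] that(2) w by (meson order_trans order_less_imp_le)
        qed
        thus ?thesis using lt uv(1) by simp
      qed
    qed
    have "\<exists>a b c. I \<subseteq> {a, b, c}"
    proof -
      obtain xs where xs: "set xs = I" "distinct xs" using finite_distinct_list[of I] by auto
      hence "length xs \<le> 3" using True distinct_card[OF xs(2)] by simp
      then consider "xs = []" | a where "xs = [a]" | a b where "xs = [a, b]" | a b c where "xs = [a, b, c]"
        by (cases xs; cases "tl xs"; cases "tl (tl xs)"; cases "tl (tl (tl xs))") auto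
      thus ?thesis using xs(1) by cases auto
    qed
    then obtain a b c where abc: "I \<subseteq> {a, b, c}" by blast
    interpret three_generated a b c
      by unfold_locales (rule below, use abc in blast)
    from h show ?thesis by (rule polymatroid_approximable)
  next
    case False
    hence T2: "card T \<le> 2" using cards by simp
    \<comment> \<open>Two incomparable members of \<open>T\<close> would bring in their join as a
      third.\<close>
    have "s \<le> t \<or> t \<le> s" if st: "s \<in> T" "t \<in> T" for s t
    proof (rule ccontr)
      assume n: "\<not> (s \<le> t \<or> t \<le> s)"
      hence "sup s t \<in> T" by (auto simp: T_def)
      hence "{s, t, sup s t} \<subseteq> T" using st by simp
      hence "card {s, t, sup s t} \<le> card T" by (intro card_mono) auto
      moreover have "card {s, t, sup s t} = 3"
      proof -
        have "s \<noteq> t" "s \<noteq> sup s t" "t \<noteq> sup s t" using n by (metis order_refl sup_ge1 sup_ge2)+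
        thus ?thesis by simp
      qed
      ultimately show False using T2 by simp
    qed
    moreover have "sup x y \<in> T" if "\<not> x \<le> y" "\<not> y \<le> x" for x y using that by (auto simp: T_def)
    ultimately show ?thesis using h by (rule chain_approximable)
  qed
  hence "{h :: 'a \<Rightarrow> real. polymatroid h} \<subseteq> closure {h. entropic h}"
    using approximable_imp_closure_entropic by blast
  thus ?thesis unfolding shannon_lattice_def using closure_entropic_polymatroid by blast
qed

end
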